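(* Fix one type $\mathcal T\in\{K, WK, S, PL\}$; below, "$1$-Kähler" in quotation marks means generalized $1$-Kähler of type $\mathcal T$. Let $X$ and $Y$ be complex manifolds. Then $X$ and $Y$ are both "$1$-Kähler" if and only if $X\times Y$ is "$1$-Kähler".
   Context: A real $(1,1)$-form on a complex manifold is transverse if and only if it is strictly positive at every point, i.e. it is the fundamental form of a Hermitian metric. All forms are smooth. A complex manifold $X$ is generalized $1$-Kähler of - type K (Kähler) if it has a transverse real $(1,1)$-form $\omega$ with $d\omega=0$; - type WK if it has a transverse real $(1,1)$-form $\omega$ with $\partial\omega=\partial\bar\partial\alpha$ for some form $\alpha$; - type S (Hermitian symplectic) if it has a closed real $2$-form $\Psi$ whose $(1,1)$-component $\Psi^{1,1}$ is transverse; - type PL (SKT, pluriclosed) if it has a transverse real $(1,1)$-form $\omega$ with $\partial\bar\partial\omega=0$. Complex manifolds are nonempty, of positive dimension, connected, Hausdorff and second countable, and need not be compact. *)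

theory Defs
  imports "HOL-Analysis.Analysis"
begin

section \<open>Smooth functions, holomorphic maps in several variables\<close>

text \<open>On an open subset of a finite-dimensional space, \<open>Ck_on k S f\<close> says that \<open>f\<close> is of class
  \<open>C^k\<close> in the real sense: all iterated directional derivatives of order at most \<open>k\<close> exist and
  are continuous.\<close>

primrec Ck_on ::
  "nat \<Rightarrow> 'a::real_normed_vector set \<Rightarrow> ('a \<Rightarrow> 'b::real_normed_vector) \<Rightarrow> bool" where
  "Ck_on 0 S f \<longleftrightarrow> continuous_on S f"
| "Ck_on (Suc k) S f \<longleftrightarrow>
     (\<forall>x\<in>S. f differentiable (at x)) \<and>
     (\<forall>v. Ck_on k S (\<lambda>x. frechet_derivative f (at x) v))"

definition Cinf_on :: "'a::real_normed_vector set \<Rightarrow> ('a \<Rightarrow> 'b::real_normed_vector) \<Rightarrow> bool" where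
  "Cinf_on S f \<longleftrightarrow> (\<forall>k. Ck_on k S f)"

text \<open>The sets \<open>S\<close> below are open. \<open>c *s v\<close> is complex scalar multiplication, whereas
  \<open>has_derivative\<close> refers to the underlying real vector space.\<close>

definition holomorphic_map_on ::
  "(complex^'n::finite) set \<Rightarrow> (complex^'n \<Rightarrow> complex^'m::finite) \<Rightarrow> bool" where
  "holomorphic_map_on S f \<longleftrightarrow>
     (\<forall>x\<in>S. \<exists>D. (f has_derivative D) (at x) \<and> (\<forall>c v. D (c *s v) = c *s D v))"


section \<open>Complex manifolds\<close>

text \<open>A chart is a pair of its domain and its coordinate map; the values of the map outside of
  the domain are irrelevant.\<close>

type_synonym ('a, 'n) chart = "'a set \<times> ('a \<Rightarrow> complex^'n)"

record ('a, 'n::finite) cmfd =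
  mtop :: "'a topology"
  atlas :: "('a, 'n) chart set"

definition is_chart :: "'a topology \<Rightarrow> ('a, 'n::finite) chart \<Rightarrow> bool" where
  "is_chart X c \<longleftrightarrow> (case c of (U, \<phi>) \<Rightarrow>
     openin X U \<and> open (\<phi> ` U) \<and>
     homeomorphic_map (subtopology X U) (top_of_set (\<phi> ` U)) \<phi>)"

definition chart_overlap ::
  "('a, 'n::finite) chart \<Rightarrow> ('a, 'n) chart \<Rightarrow> (complex^'n) set" where
  "chart_overlap c c' = snd c ` (fst c \<inter> fst c')"

definition transition ::
  "('a, 'n::finite) chart \<Rightarrow> ('a, 'n) chart \<Rightarrow> complex^'n \<Rightarrow> complex^'n" where
  "transition c c' = snd c' \<circ> inv_into (fst c) (snd c)"

text \<open>The atlas need not be maximal. A connected complex manifold has the same dimension at all of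
  its points, here \<open>CARD('n)\<close>, which is positive.\<close>

definition complex_manifold :: "('a, 'n::finite) cmfd \<Rightarrow> bool" where
  "complex_manifold M \<longleftrightarrow>
     topspace (mtop M) \<noteq> {} \<and> connected_space (mtop M) \<and>
     Hausdorff_space (mtop M) \<and> second_countable (mtop M) \<and>
     (\<forall>c\<in>atlas M. is_chart (mtop M) c) \<and>
     (\<Union>c\<in>atlas M. fst c) = topspace (mtop M) \<and>
     (\<forall>c\<in>atlas M. \<forall>c'\<in>atlas M. holomorphic_map_on (chart_overlap c c') (transition c c'))"


section \<open>Products\<close>

definition join_vec ::
  "complex^'n::finite \<Rightarrow> complex^'m::finite \<Rightarrow> complex^('n + 'm)" where
  "join_vec x y = (\<chi> i. case i of Inl j \<Rightarrow> x $ j | Inr j \<Rightarrow> y $ j)"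

definition prod_chart ::
  "('a, 'n::finite) chart \<Rightarrow> ('b, 'm::finite) chart \<Rightarrow> ('a \<times> 'b, 'n + 'm) chart" where
  "prod_chart c c' = (fst c \<times> fst c', \<lambda>(x, y). join_vec (snd c x) (snd c' y))"

definition prod_cmfd ::
  "('a, 'n::finite) cmfd \<Rightarrow> ('b, 'm::finite) cmfd \<Rightarrow> ('a \<times> 'b, 'n + 'm) cmfd"
  (infixr \<open>\<times>\<^sub>M\<^sub>f\<close> 80) where
  "prod_cmfd M N =
     \<lparr>mtop = prod_topology (mtop M) (mtop N),
      atlas = {prod_chart c c' | c c'. c \<in> atlas M \<and> c' \<in> atlas N}\<rparr>"

lemma second_countable_prod_topology:
  assumes "second_countable X" "second_countable Y"
  shows "second_countable (prod_topology X Y)"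
proof -
  obtain \<B> where B: "countable \<B>" "\<And>V. V \<in> \<B> \<Longrightarrow> openin X V"
    "\<And>U x. openin X U \<Longrightarrow> x \<in> U \<Longrightarrow> \<exists>V\<in>\<B>. x \<in> V \<and> V \<subseteq> U"
    using assms(1) unfolding second_countable_def by metis
  obtain \<C> where C: "countable \<C>" "\<And>V. V \<in> \<C> \<Longrightarrow> openin Y V"
    "\<And>U x. openin Y U \<Longrightarrow> x \<in> U \<Longrightarrow> \<exists>V\<in>\<C>. x \<in> V \<and> V \<subseteq> U"
    using assms(2) unfolding second_countable_def by metis
  let ?D = "(\<lambda>(V, W). V \<times> W) ` (\<B> \<times> \<C>)"
  have "countable ?D"
    using B(1) C(1) by auto
  moreover have "\<forall>D\<in>?D. openin (prod_topology X Y) D"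
    using B(2) C(2) by (auto simp: openin_prod_Times_iff)
  moreover have "\<exists>D\<in>?D. z \<in> D \<and> D \<subseteq> U" if U: "openin (prod_topology X Y) U" and z: "z \<in> U" for U z
  proof -
    obtain x y where xy: "z = (x, y)" by fastforce
    obtain U1 U2 where u: "openin X U1" "openin Y U2" "x \<in> U1" "y \<in> U2" "U1 \<times> U2 \<subseteq> U"
      using U z unfolding openin_prod_topology_alt xy by meson
    obtain V W where "V \<in> \<B>" "x \<in> V" "V \<subseteq> U1" "W \<in> \<C>" "y \<in> W" "W \<subseteq> U2"
      using B(3)[OF u(1,3)] C(3)[OF u(2,4)] by blast
    then show ?thesis
      using u(5) xy by (intro bexI[of _ "V \<times> W"]) auto
  qed
  ultimately show ?thesis
    unfolding second_countable_def by (intro exI[of _ ?D]) simp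
qed

definition left_vec :: "complex^('n::finite + 'm::finite) \<Rightarrow> complex^'n" where
  "left_vec z = (\<chi> i. z $ Inl i)"

definition right_vec :: "complex^('n::finite + 'm::finite) \<Rightarrow> complex^'m" where
  "right_vec z = (\<chi> i. z $ Inr i)"

lemma left_join [simp]: "left_vec (join_vec x y) = x"
  and right_join [simp]: "right_vec (join_vec x y) = y"
  by (simp_all add: left_vec_def right_vec_def join_vec_def vec_eq_iff)

lemma join_left_right [simp]: "join_vec (left_vec z) (right_vec z) = z"
  by (simp add: left_vec_def right_vec_def join_vec_def vec_eq_iff split: sum.split)

lemma join_vec_scale: "join_vec (c *s x) (c *s y) = c *s join_vec x y"
  by (simp add: join_vec_def vec_eq_iff split: sum.split)

lemma linear_left_vec: "linear left_vec" and linear_right_vec: "linear right_vec"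
  by (intro linearI; simp add: left_vec_def right_vec_def vec_eq_iff)+

lemma linear_join_vec: "linear (\<lambda>z. join_vec (fst z) (snd z))"
  by (intro linearI) (simp_all add: join_vec_def vec_eq_iff split: sum.split)

lemma homeomorphism_join_vec:
  "homeomorphism S ((\<lambda>z. join_vec (fst z) (snd z)) ` S)
     (\<lambda>z. join_vec (fst z) (snd z)) (\<lambda>z. (left_vec z, right_vec z))"
proof (rule homeomorphismI)
  show "continuous_on S (\<lambda>z. join_vec (fst z) (snd z))"
    by (intro linear_continuous_on linear_join_vec[unfolded linear_conv_bounded_linear])
  show "continuous_on ((\<lambda>z. join_vec (fst z) (snd z)) ` S) (\<lambda>z. (left_vec z, right_vec z))"
    by (intro continuous_on_Pair linear_continuous_on
        linear_left_vec[unfolded linear_conv_bounded_linear]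
        linear_right_vec[unfolded linear_conv_bounded_linear])
qed (auto simp: image_image)

lemma open_join_vec:
  fixes S :: "((complex^'n::finite) \<times> (complex^'m::finite)) set"
  assumes "open S"
  shows "open ((\<lambda>z. join_vec (fst z) (snd z)) ` S)"
proof -
  have eq: "(\<lambda>z. join_vec (fst z) (snd z)) ` S = (\<lambda>z. (left_vec z, right_vec z)) -` S"
  proof (intro equalityI subsetI)
    fix z assume "z \<in> (\<lambda>z. (left_vec z, right_vec z)) -` S"
    then show "z \<in> (\<lambda>z. join_vec (fst z) (snd z)) ` S"
      by (intro image_eqI[of _ _ "(left_vec z, right_vec z)"]) simp_all
  qed auto
  have "continuous_on UNIV (\<lambda>z::complex^('n+'m). (left_vec z, right_vec z))"
    by (intro continuous_on_Pair linear_continuous_on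
        linear_left_vec[unfolded linear_conv_bounded_linear]
        linear_right_vec[unfolded linear_conv_bounded_linear])
  from open_vimage[OF assms this] show ?thesis unfolding eq .
qed

lemma is_chart_prod_chart:
  fixes c :: "('a, 'n::finite) chart" and c' :: "('b, 'm::finite) chart"
  assumes "is_chart X c" "is_chart Y c'"
  shows "is_chart (prod_topology X Y) (prod_chart c c')"
proof -
  obtain U \<phi> V \<psi> where [simp]: "c = (U, \<phi>)" "c' = (V, \<psi>)" by fastforce
  let ?j = "\<lambda>z. join_vec (fst z) (snd z)" and ?h = "\<lambda>(x, y). (\<phi> x, \<psi> y)"
  have a: "openin X U" "open (\<phi> ` U)" "homeomorphic_map (subtopology X U) (top_of_set (\<phi> ` U)) \<phi>"
    "openin Y V" "open (\<psi> ` V)" "homeomorphic_map (subtopology Y V) (top_of_set (\<psi> ` V)) \<psi>"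
    using assms by (auto simp: is_chart_def)
  have im: "(\<lambda>(x, y). join_vec (\<phi> x) (\<psi> y)) ` (U \<times> V) = ?j ` (\<phi> ` U \<times> \<psi> ` V)"
    by force
  have "homeomorphic_map (prod_topology (subtopology X U) (subtopology Y V))
          (prod_topology (top_of_set (\<phi> ` U)) (top_of_set (\<psi> ` V))) ?h"
    using a(3,6) unfolding homeomorphic_map_maps by (metis homeomorphic_maps_prod)
  then have "homeomorphic_map (subtopology (prod_topology X Y) (U \<times> V))
               (top_of_set (\<phi> ` U \<times> \<psi> ` V)) ?h"
    by (simp add: subtopology_Times)
  moreover have "homeomorphic_map (top_of_set (\<phi> ` U \<times> \<psi> ` V)) (top_of_set (?j ` (\<phi> ` U \<times> \<psi> ` V))) ?j"
    using homeomorphism_join_vec[of "\<phi> ` U \<times> \<psi> ` V"]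
    unfolding homeomorphic_map_maps homeomorphic_maps_def homeomorphism_def by (intro exI[of _ "\<lambda>z. (left_vec z, right_vec z)"]) auto
  ultimately have "homeomorphic_map (subtopology (prod_topology X Y) (U \<times> V))
          (top_of_set (?j ` (\<phi> ` U \<times> \<psi> ` V))) (?j \<circ> ?h)"
    by (rule homeomorphic_map_compose)
  moreover have "?j \<circ> ?h = (\<lambda>(x, y). join_vec (\<phi> x) (\<psi> y))" by auto
  ultimately have hom: "homeomorphic_map (subtopology (prod_topology X Y) (U \<times> V))
      (top_of_set ((\<lambda>(x, y). join_vec (\<phi> x) (\<psi> y)) ` (U \<times> V)))
      (\<lambda>(x, y). join_vec (\<phi> x) (\<psi> y))"
    by (simp only: im)
  have "openin (prod_topology X Y) (U \<times> V)"
    using a(1,4) by (simp add: openin_prod_Times_iff)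
  moreover have "open ((\<lambda>(x, y). join_vec (\<phi> x) (\<psi> y)) ` (U \<times> V))"
    unfolding im by (intro open_join_vec open_Times a)
  ultimately show ?thesis
    using hom by (simp only: is_chart_def prod_chart_def split fst_conv snd_conv \<open>c = (U, \<phi>)\<close>
        \<open>c' = (V, \<psi>)\<close> simp_thms)
qed

lemma chart_overlap_prod_chart:
  "chart_overlap (prod_chart c1 c1') (prod_chart c2 c2') =
     (\<lambda>z. join_vec (fst z) (snd z)) ` (chart_overlap c1 c2 \<times> chart_overlap c1' c2')"
proof -
  have "chart_overlap (prod_chart c1 c1') (prod_chart c2 c2') =
      (\<lambda>(x, y). join_vec (snd c1 x) (snd c1' y)) `
        ((fst c1 \<inter> fst c2) \<times> (fst c1' \<inter> fst c2'))"
    by (simp add: chart_overlap_def prod_chart_def Times_Int_Times)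
  also have "\<dots> = (\<lambda>z. join_vec (fst z) (snd z)) `
      (map_prod (snd c1) (snd c1') ` ((fst c1 \<inter> fst c2) \<times> (fst c1' \<inter> fst c2')))"
    by (simp add: image_image case_prod_unfold)
  finally show ?thesis
    by (simp add: chart_overlap_def map_prod_surj_on)
qed

lemma inv_into_chart:
  assumes "is_chart X c" "a \<in> fst c"
  shows "inv_into (fst c) (snd c) (snd c a) = a"
proof -
  have "fst c \<subseteq> topspace X"
    using assms(1) openin_subset by (force simp: is_chart_def)
  then have "inj_on (snd c) (fst c)"
    using assms(1) by (auto simp: is_chart_def homeomorphic_map_def quotient_map_def Int_absorb1
        dest!: homeomorphic_imp_injective_map)
  then show ?thesis using assms(2) by simp
qed

lemma open_chart_overlap:
  assumes "is_chart X c" "is_chart X c'"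
  shows "open (chart_overlap c c')"
proof -
  have "openin X (fst c \<inter> fst c')"
    using assms by (auto simp: is_chart_def)
  then have "openin (subtopology X (fst c)) (fst c \<inter> fst c')"
    using assms(1) by (auto simp: openin_open_subtopology is_chart_def)
  then have "openin (top_of_set (snd c ` fst c)) (chart_overlap c c')"
    using assms(1) homeomorphic_imp_open_map
    unfolding is_chart_def chart_overlap_def open_map_def by (metis (no_types, lifting) case_prod_unfold)
  then show ?thesis
    using assms(1) by (auto simp: is_chart_def intro: openin_open_trans)
qed

lemma transition_prod_chart:
  assumes "is_chart X c1" "is_chart X c2" "is_chart Y c1'" "is_chart Y c2'"
    and "x \<in> chart_overlap c1 c2" "y \<in> chart_overlap c1' c2'"
  shows "transition (prod_chart c1 c1') (prod_chart c2 c2') (join_vec x y) =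
           join_vec (transition c1 c2 x) (transition c1' c2' y)"
proof -
  obtain a b where ab: "x = snd c1 a" "a \<in> fst c1" "a \<in> fst c2"
      "y = snd c1' b" "b \<in> fst c1'" "b \<in> fst c2'"
    using assms by (auto simp: chart_overlap_def)
  have e: "join_vec x y = snd (prod_chart c1 c1') (a, b)" and m: "(a, b) \<in> fst (prod_chart c1 c1')"
    using ab by (auto simp: prod_chart_def)
  show ?thesis
    unfolding transition_def o_apply e inv_into_chart[OF is_chart_prod_chart[OF assms(1,3)] m]
    using ab inv_into_chart[OF assms(1) ab(2)] inv_into_chart[OF assms(3) ab(5)]
    by (simp add: prod_chart_def)
qed

lemma holomorphic_transition_prod_chart:
  assumes c: "is_chart X c1" "is_chart X c2" "is_chart Y c1'" "is_chart Y c2'"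
    and h: "holomorphic_map_on (chart_overlap c1 c2) (transition c1 c2)"
      "holomorphic_map_on (chart_overlap c1' c2') (transition c1' c2')"
  shows "holomorphic_map_on (chart_overlap (prod_chart c1 c1') (prod_chart c2 c2'))
           (transition (prod_chart c1 c1') (prod_chart c2 c2'))"
  unfolding holomorphic_map_on_def
proof
  fix z assume z: "z \<in> chart_overlap (prod_chart c1 c1') (prod_chart c2 c2')"
  then have xy: "left_vec z \<in> chart_overlap c1 c2" "right_vec z \<in> chart_overlap c1' c2'"
    by (auto simp: chart_overlap_prod_chart)
  obtain D where D: "(transition c1 c2 has_derivative D) (at (left_vec z))"
      "\<And>s v. D (s *s v) = s *s D v"
    using h(1) xy(1) unfolding holomorphic_map_on_def by blast
  obtain D' where D': "(transition c1' c2' has_derivative D') (at (right_vec z))"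
      "\<And>s v. D' (s *s v) = s *s D' v"
    using h(2) xy(2) unfolding holomorphic_map_on_def by blast
  note bl = linear_left_vec[unfolded linear_conv_bounded_linear]
    linear_right_vec[unfolded linear_conv_bounded_linear]
    linear_join_vec[unfolded linear_conv_bounded_linear]
  let ?f = "\<lambda>z. join_vec (transition c1 c2 (left_vec z)) (transition c1' c2' (right_vec z))"
  let ?E = "\<lambda>v. join_vec (D (left_vec v)) (D' (right_vec v))"
  have "((\<lambda>z. (transition c1 c2 (left_vec z), transition c1' c2' (right_vec z)))
           has_derivative (\<lambda>v. (D (left_vec v), D' (right_vec v)))) (at z)"
    by (intro has_derivative_Pair has_derivative_compose[OF bounded_linear_imp_has_derivative[OF bl(1)] D(1)]
        has_derivative_compose[OF bounded_linear_imp_has_derivative[OF bl(2)] D'(1)])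
  from bounded_linear.has_derivative[OF bl(3) this]
  have E: "(?f has_derivative ?E) (at z)" by simp
  have op: "open (chart_overlap (prod_chart c1 c1') (prod_chart c2 c2'))"
    by (rule open_chart_overlap[OF is_chart_prod_chart[OF c(1,3)] is_chart_prod_chart[OF c(2,4)]])
  have "(transition (prod_chart c1 c1') (prod_chart c2 c2') has_derivative ?E) (at z)"
  proof (rule has_derivative_transform_within_open[OF E op z])
    fix w assume "w \<in> chart_overlap (prod_chart c1 c1') (prod_chart c2 c2')"
    then have "left_vec w \<in> chart_overlap c1 c2" "right_vec w \<in> chart_overlap c1' c2'"
      by (auto simp: chart_overlap_prod_chart)
    from transition_prod_chart[OF c this]
    show "?f w = transition (prod_chart c1 c1') (prod_chart c2 c2') w" by simp
  qed
  moreover have "?E (s *s v) = s *s ?E v" for s v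
  proof -
    have "left_vec (s *s v) = s *s left_vec v" "right_vec (s *s v) = s *s right_vec v"
      by (simp_all add: left_vec_def right_vec_def vec_eq_iff)
    then show ?thesis by (simp add: D(2) D'(2) join_vec_scale)
  qed
  ultimately show "\<exists>E. (transition (prod_chart c1 c1') (prod_chart c2 c2') has_derivative E) (at z) \<and>
      (\<forall>s v. E (s *s v) = s *s E v)" by blast
qed

lemma complex_manifold_prod_cmfd:
  assumes "complex_manifold M" "complex_manifold N"
  shows "complex_manifold (M \<times>\<^sub>M\<^sub>f N)"
proof -
  let ?P = "M \<times>\<^sub>M\<^sub>f N"
  have "(\<Union>c\<in>atlas ?P. fst c) = (\<Union>c\<in>atlas M. fst c) \<times> (\<Union>c\<in>atlas N. fst c)"
    by (force simp: prod_cmfd_def prod_chart_def)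
  then have "(\<Union>c\<in>atlas ?P. fst c) = topspace (mtop ?P)"
    using assms by (simp add: complex_manifold_def prod_cmfd_def)
  moreover have "\<forall>c\<in>atlas ?P. is_chart (mtop ?P) c"
    using assms is_chart_prod_chart unfolding complex_manifold_def prod_cmfd_def
    by (smt (verit, best) cmfd.select_convs mem_Collect_eq)
  moreover have "\<forall>c\<in>atlas ?P. \<forall>c'\<in>atlas ?P. holomorphic_map_on (chart_overlap c c') (transition c c')"
  proof (intro ballI)
    fix c c' assume "c \<in> atlas ?P" "c' \<in> atlas ?P"
    then obtain c1 c1' c2 c2' where "c = prod_chart c1 c1'" "c' = prod_chart c2 c2'"
        "c1 \<in> atlas M" "c1' \<in> atlas N" "c2 \<in> atlas M" "c2' \<in> atlas N"
      by (auto simp: prod_cmfd_def)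
    then show "holomorphic_map_on (chart_overlap c c') (transition c c')"
      using assms holomorphic_transition_prod_chart[of "mtop M" c1 c2 "mtop N" c1' c2']
      by (simp add: complex_manifold_def)
  qed
  moreover have "topspace (mtop ?P) \<noteq> {}" "connected_space (mtop ?P)"
      "Hausdorff_space (mtop ?P)" "second_countable (mtop ?P)"
    using assms
    by (simp_all add: complex_manifold_def prod_cmfd_def connected_space_prod_topology
        Hausdorff_space_prod_topology second_countable_prod_topology)
  ultimately show ?thesis
    unfolding complex_manifold_def by (intro conjI)
qed


section \<open>Differential forms on open subsets of complex number space\<close>

text \<open>A complex-valued \<open>k\<close>-covector takes a list of \<open>k\<close> tangent vectors; it is extended by
  \<open>0\<close> to lists of other lengths. Linearity is over the reals. A form assigns a covector
  to each point.\<close>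

type_synonym 'n covector = "(complex^'n) list \<Rightarrow> complex"
type_synonym 'n local_form = "complex^'n \<Rightarrow> 'n covector"

definition alternating :: "nat \<Rightarrow> 'n::finite covector \<Rightarrow> bool" where
  "alternating k A \<longleftrightarrow>
     (\<forall>vs. length vs \<noteq> k \<longrightarrow> A vs = 0) \<and>
     (\<forall>vs i. length vs = k \<longrightarrow> i < k \<longrightarrow> linear (\<lambda>v. A (vs[i := v]))) \<and>
     (\<forall>vs. length vs = k \<longrightarrow> \<not> distinct vs \<longrightarrow> A vs = 0)"

definition pullback ::
  "(complex^'n::finite \<Rightarrow> complex^'m::finite) \<Rightarrow> 'm local_form \<Rightarrow> 'n local_form" where
  "pullback f \<omega> p vs = \<omega> (f p) (map (frechet_derivative f (at p)) vs)"

definition omit :: "nat \<Rightarrow> 'a list \<Rightarrow> 'a list" where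
  "omit i vs = take i vs @ drop (Suc i) vs"

text \<open>The operator \<open>d\<close> on forms, in terms of constant vector fields on the chart.\<close>

definition ext_d :: "'n::finite local_form \<Rightarrow> 'n local_form" where
  "ext_d \<omega> p vs =
     (\<Sum>i<length vs. (-1) ^ i * frechet_derivative (\<lambda>q. \<omega> q (omit i vs)) (at p) (vs ! i))"

text \<open>Complex-linear and conjugate-linear parts of a real-linear functional. If \<open>L\<close> is the
  differential of \<open>f\<close> at a point, then \<open>part10 L\<close> is the sum of the
  \<open>(\<partial>f/\<partial>z_j) dz_j\<close>, and \<open>part01 L\<close> is its counterpart for the conjugate coordinates.\<close>

definition part10 :: "(complex^'n::finite \<Rightarrow> complex) \<Rightarrow> complex^'n \<Rightarrow> complex" where
  "part10 L v = (L v - \<i> * L (\<i> *s v)) / 2"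

definition part01 :: "(complex^'n::finite \<Rightarrow> complex) \<Rightarrow> complex^'n \<Rightarrow> complex" where
  "part01 L v = (L v + \<i> * L (\<i> *s v)) / 2"

text \<open>Write \<open>\<zeta>_j\<close> for the conjugate of \<open>z_j\<close>. The two operators are
  \<open>del (f dz_I \<and> d\<zeta>_J) = \<Sum>j. (\<partial>f/\<partial>z_j) dz_j \<and> dz_I \<and> d\<zeta>_J\<close> and
  \<open>delbar (f dz_I \<and> d\<zeta>_J) = \<Sum>j. (\<partial>f/\<partial>\<zeta>_j) d\<zeta>_j \<and> dz_I \<and> d\<zeta>_J\<close>:
  the covectors \<open>dz_I \<and> d\<zeta>_J\<close> are constant in the chart, so only the coefficients are
  differentiated.\<close>

definition del :: "'n::finite local_form \<Rightarrow> 'n local_form" where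
  "del \<omega> p vs =
     (\<Sum>i<length vs. (-1) ^ i *
        part10 (frechet_derivative (\<lambda>q. \<omega> q (omit i vs)) (at p)) (vs ! i))"

definition delbar :: "'n::finite local_form \<Rightarrow> 'n local_form" where
  "delbar \<omega> p vs =
     (\<Sum>i<length vs. (-1) ^ i *
        part01 (frechet_derivative (\<lambda>q. \<omega> q (omit i vs)) (at p)) (vs ! i))"

lemma ext_d_eq_del_plus_delbar: "ext_d \<omega> p vs = del \<omega> p vs + delbar \<omega> p vs"
  unfolding ext_d_def del_def delbar_def sum.distrib[symmetric]
  by (rule sum.cong) (auto simp: part10_def part01_def field_simps)

text \<open>The \<open>(p,q)\<close>-component of a \<open>(p+q)\<close>-covector \<open>A\<close>. Write each vector as
  \<open>v = (v - \<i> Jv)/2 + (v + \<i> Jv)/2\<close> in the complexified tangent space, where the summands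
  have types \<open>(1,0)\<close> and \<open>(0,1)\<close> and \<open>Jv = \<i> *s v\<close>, and extend \<open>A\<close> complex-multilinearly. The
  component is the sum over all sets \<open>S\<close> of \<open>p\<close> slots of the value of \<open>A\<close> with the
  \<open>(1,0)\<close>-summands in the slots in \<open>S\<close> and the \<open>(0,1)\<close>-summands in the others. The sum
  over \<open>T\<close> is the expansion of this value; \<open>T\<close> is the set of slots in which \<open>J\<close> is
  applied.\<close>

definition pq_component :: "nat \<Rightarrow> nat \<Rightarrow> 'n::finite covector \<Rightarrow> 'n covector" where
  "pq_component p q A vs =
     (if length vs = p + q then
        (\<Sum>S | S \<subseteq> {..<p+q} \<and> card S = p.
           (\<Sum>T | T \<subseteq> {..<p+q}.
              (\<Prod>j\<in>T. if j \<in> S then - \<i> else \<i>) *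
              A (map (\<lambda>j. if j \<in> T then \<i> *s (vs ! j) else vs ! j) [0..<p+q])) / 2 ^ (p + q))
      else 0)"

lemma pq_component_1_1:
  "pq_component 1 1 A [v, w] = (A [v, w] + A [\<i> *s v, \<i> *s w]) / 2"
proof -
  have P: "{T. T \<subseteq> {..<1+1::nat}} = {{}, {0}, {1}, {0,1}}"
  proof -
    have "{..<1+1::nat} = {0,1}" by auto
    then show ?thesis by auto
  qed
  have S: "{S. S \<subseteq> {..<1+1::nat} \<and> card S = 1} = {{0}, {1}}"
  proof -
    have "{S. S \<subseteq> {..<1+1::nat} \<and> card S = 1} = {S \<in> {T. T \<subseteq> {..<1+1::nat}}. card S = 1}" by auto
    also have "\<dots> = {{0}, {1}}" unfolding P by (auto simp: card_insert_if)
    finally show ?thesis .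
  qed
  have ne: "({0} :: nat set) \<noteq> {0,1}" "({1} :: nat set) \<noteq> {0,1}" "{Suc 0} \<noteq> {0, Suc 0}"
    by auto
  show ?thesis
    unfolding pq_component_def P S
    by (simp add: ne field_simps)
qed


section \<open>Differential forms on complex manifolds\<close>

text \<open>A form on a manifold is a family of local forms on the images of the charts that are related
  by pullback along the transition maps. Two such families are the same form if they
  agree on the images of the charts. Closedness, type and so on are tested in each chart.\<close>

type_synonym ('a, 'n) mform = "('a, 'n) chart \<Rightarrow> 'n local_form"

definition smooth_form :: "('a, 'n::finite) cmfd \<Rightarrow> nat \<Rightarrow> ('a, 'n) mform \<Rightarrow> bool" where
  "smooth_form M k \<omega> \<longleftrightarrow>
     (\<forall>c\<in>atlas M. \<forall>p\<in>snd c ` fst c. alternating k (\<omega> c p)) \<and>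
     (\<forall>c\<in>atlas M. \<forall>vs. Cinf_on (snd c ` fst c) (\<lambda>p. \<omega> c p vs)) \<and>
     (\<forall>c\<in>atlas M. \<forall>c'\<in>atlas M. \<forall>p\<in>chart_overlap c c'. \<forall>vs.
        \<omega> c p vs = pullback (transition c c') (\<omega> c') p vs)"

definition form_eq ::
  "('a, 'n::finite) cmfd \<Rightarrow> ('a, 'n) mform \<Rightarrow> ('a, 'n) mform \<Rightarrow> bool" where
  "form_eq M \<omega> \<eta> \<longleftrightarrow> (\<forall>c\<in>atlas M. \<forall>p\<in>snd c ` fst c. \<forall>vs. \<omega> c p vs = \<eta> c p vs)"

definition zero_form :: "('a, 'n::finite) mform" where
  "zero_form c p vs = 0"

definition mdiff :: "('a, 'n::finite) mform \<Rightarrow> ('a, 'n) mform" where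
  "mdiff \<omega> c = ext_d (\<omega> c)"

definition mdel :: "('a, 'n::finite) mform \<Rightarrow> ('a, 'n) mform" where
  "mdel \<omega> c = del (\<omega> c)"

definition mdelbar :: "('a, 'n::finite) mform \<Rightarrow> ('a, 'n) mform" where
  "mdelbar \<omega> c = delbar (\<omega> c)"

definition mcomponent :: "nat \<Rightarrow> nat \<Rightarrow> ('a, 'n::finite) mform \<Rightarrow> ('a, 'n) mform" where
  "mcomponent p q \<omega> c x = pq_component p q (\<omega> c x)"

definition real_form :: "('a, 'n::finite) cmfd \<Rightarrow> ('a, 'n) mform \<Rightarrow> bool" where
  "real_form M \<omega> \<longleftrightarrow> (\<forall>c\<in>atlas M. \<forall>p\<in>snd c ` fst c. \<forall>vs. \<omega> c p vs \<in> \<real>)"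

definition real_11_form :: "('a, 'n::finite) cmfd \<Rightarrow> ('a, 'n) mform \<Rightarrow> bool" where
  "real_11_form M \<omega> \<longleftrightarrow>
     smooth_form M 2 \<omega> \<and> real_form M \<omega> \<and> form_eq M (mcomponent 1 1 \<omega>) \<omega>"

text \<open>For a real \<open>(1,1)\<close>-form \<open>\<omega>\<close>, the bilinear form \<open>g(v,w) = \<omega>(v,Jw)\<close> is symmetric and
  \<open>J\<close>-invariant; \<open>\<omega>\<close> is the fundamental form of a Hermitian metric iff \<open>g\<close> is positive
  definite. In a chart, with \<open>\<omega> = \<i> \<Sum>j k. h_jk dz_j \<and> d\<zeta>_k\<close> and \<open>\<zeta>_k\<close> the conjugate of \<open>z_k\<close>,
  \<open>g(v,v)\<close> is twice the value at \<open>v\<close> of the Hermitian form with matrix \<open>h\<close>.\<close>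

definition transverse_11_form :: "('a, 'n::finite) cmfd \<Rightarrow> ('a, 'n) mform \<Rightarrow> bool" where
  "transverse_11_form M \<omega> \<longleftrightarrow>
     real_11_form M \<omega> \<and>
     (\<forall>c\<in>atlas M. \<forall>p\<in>snd c ` fst c. \<forall>v. v \<noteq> 0 \<longrightarrow> 0 < Re (\<omega> c p [v, \<i> *s v]))"


section \<open>Generalized 1-Kaehler manifolds\<close>

datatype kahler_type = Type_K | Type_WK | Type_S | Type_PL

fun generalized_1_kahler :: "kahler_type \<Rightarrow> ('a, 'n::finite) cmfd \<Rightarrow> bool" where
  "generalized_1_kahler Type_K M \<longleftrightarrow>
     (\<exists>\<omega>. transverse_11_form M \<omega> \<and> form_eq M (mdiff \<omega>) zero_form)"
| "generalized_1_kahler Type_WK M \<longleftrightarrow>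
     (\<exists>\<omega>. transverse_11_form M \<omega> \<and>
        (\<exists>k \<alpha>. smooth_form M k \<alpha> \<and> form_eq M (mdel \<omega>) (mdel (mdelbar \<alpha>))))"
| "generalized_1_kahler Type_S M \<longleftrightarrow>
     (\<exists>\<Psi>. smooth_form M 2 \<Psi> \<and> real_form M \<Psi> \<and> form_eq M (mdiff \<Psi>) zero_form \<and>
        transverse_11_form M (mcomponent 1 1 \<Psi>))"
| "generalized_1_kahler Type_PL M \<longleftrightarrow>
     (\<exists>\<omega>. transverse_11_form M \<omega> \<and> form_eq M (mdel (mdelbar \<omega>)) zero_form)"

end

theory Submission
  imports Defs
begin

text \<open>If \<open>\<omega>\<close> and \<open>\<eta>\<close> are structures of the given type on \<open>X\<close> and \<open>Y\<close>, then the sum of their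
  pullbacks along the two projections is one on \<open>X \<times> Y\<close>. Conversely, a structure on \<open>X \<times> Y\<close>
  restricts to the slices \<open>X \<times> {y}\<close> and \<open>{x} \<times> Y\<close>. In product charts the projections and the
  inclusions of slices are affine with complex-linear part, so that pullback along them commutes
  with \<open>\<partial>\<close>, with its conjugate and with the decomposition into types.\<close>

section \<open>Calculus on open sets: locality, sums and affine substitution\<close>

section \<open>Smooth functions\<close>

text \<open>\<open>frechet_derivative\<close> is a choice among all \<open>D\<close> with
  \<open>has_derivative\<close>, and at \<open>x\<close> both functions admit the same
  \<open>D\<close>. Hence the two choices coincide, even at a point where no derivative
  exists.\<close>

lemma frechet_derivative_cong_open:
  assumes "open S" "x \<in> S" "\<And>y. y \<in> S \<Longrightarrow> f y = g y"
  shows "frechet_derivative f (at x) = frechet_derivative g (at x)"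
proof -
  have "(f has_derivative D) (at x) \<longleftrightarrow> (g has_derivative D) (at x)" for D
    using has_derivative_transform_within_open[OF _ assms(1,2)] assms(3) by metis
  then show ?thesis by (simp add: frechet_derivative_def)
qed

lemma Ck_on_cong:
  assumes "open S" "\<And>x. x \<in> S \<Longrightarrow> f x = g x" "Ck_on k S f"
  shows "Ck_on k S g"
  using assms(2,3)
proof (induction k arbitrary: f g)
  case 0
  then show ?case by (metis Ck_on.simps(1) continuous_on_cong)
next
  case (Suc k)
  have "g differentiable (at x)" if "x \<in> S" for x
    using Suc.prems that assms(1) unfolding differentiable_def Ck_on.simps
    by (metis has_derivative_transform_within_open)
  moreover have "Ck_on k S (\<lambda>x. frechet_derivative g (at x) v)" for v
    using Suc.IH[of "\<lambda>x. frechet_derivative f (at x) v" "\<lambda>x. frechet_derivative g (at x) v"]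
      Suc.prems frechet_derivative_cong_open[OF assms(1), of _ f g] by simp
  ultimately show ?case by simp
qed

lemma Ck_on_const: "open S \<Longrightarrow> Ck_on k S (\<lambda>x. a)"
  by (induction k arbitrary: a) auto

lemma frechet_derivative_add:
  assumes "f differentiable (at x)" "g differentiable (at x)"
  shows "frechet_derivative (\<lambda>y. f y + g y) (at x) =
    (\<lambda>v. frechet_derivative f (at x) v + frechet_derivative g (at x) v)"
  using assms
  by (intro frechet_derivative_at[symmetric] has_derivative_add) (auto simp: frechet_derivative_works)

lemma Ck_on_add:
  assumes "open S" "Ck_on k S f" "Ck_on k S g"
  shows "Ck_on k S (\<lambda>x. f x + g x)"
  using assms(2,3)
proof (induction k arbitrary: f g)
  case 0
  then show ?case by (simp add: continuous_on_add)
next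
  case (Suc k)
  \<comment> \<open>The sum rule is available only at points of \<open>S\<close>, so the induction
    hypothesis for the sum of the directional derivatives is transferred by
    \<open>Ck_on_cong\<close>.\<close>
  have "Ck_on k S (\<lambda>x. frechet_derivative (\<lambda>y. f y + g y) (at x) v)" for v
    by (rule Ck_on_cong[OF assms(1) _ Suc.IH, of "\<lambda>x. frechet_derivative f (at x) v"
          "\<lambda>x. frechet_derivative g (at x) v"])
      (use Suc.prems in \<open>auto simp: frechet_derivative_add\<close>)
  then show ?case using Suc.prems by simp
qed

lemma has_derivative_affine:
  assumes "bounded_linear A"
  shows "((\<lambda>x. A x + b) has_derivative A) (at x)"
  using has_derivative_add[OF bounded_linear_imp_has_derivative[OF assms] has_derivative_const, of b]
  by simp

lemma has_derivative_compose_affine: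
  assumes "bounded_linear A" "f differentiable (at (A x + b))"
  shows "((\<lambda>x. f (A x + b)) has_derivative
    (\<lambda>v. frechet_derivative f (at (A x + b)) (A v))) (at x)"
  using has_derivative_compose[OF has_derivative_affine[OF assms(1)]] assms(2)
  by (simp add: frechet_derivative_works)

lemma frechet_derivative_compose_affine:
  assumes "bounded_linear A" "f differentiable (at (A x + b))"
  shows "frechet_derivative (\<lambda>x. f (A x + b)) (at x) =
    (\<lambda>v. frechet_derivative f (at (A x + b)) (A v))"
  using frechet_derivative_at[OF has_derivative_compose_affine[OF assms]] by simp

text \<open>By the chain rule, the derivative along \<open>v\<close> is the derivative of
  \<open>f\<close> along the constant vector \<open>A v\<close>, composed with the same affine map.
  No product of derivatives appears, so the induction on \<open>k\<close> closes.\<close>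

lemma Ck_on_compose_affine:
  assumes "bounded_linear A" "open S" "\<And>x. x \<in> S \<Longrightarrow> A x + b \<in> T" "Ck_on k T f"
  shows "Ck_on k S (\<lambda>x. f (A x + b))"
  using assms(4)
proof (induction k arbitrary: f)
  case 0
  have "continuous_on S (\<lambda>x. A x + b)"
    using assms(1) by (intro continuous_intros) (auto intro: linear_continuous_on)
  then show ?case
    using 0 assms(3) by (auto intro!: continuous_on_compose2[of T f])
next
  case (Suc k)
  have d: "f differentiable (at (A x + b))" if "x \<in> S" for x
    using Suc.prems assms(3)[OF that] by simp
  have "Ck_on k S (\<lambda>x. frechet_derivative (\<lambda>y. f (A y + b)) (at x) v)" for v
    by (rule Ck_on_cong[OF assms(2) _ Suc.IH, of "\<lambda>y. frechet_derivative f (at y) (A v)"])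
      (use Suc.prems d in \<open>auto simp: frechet_derivative_compose_affine[OF assms(1)]\<close>)
  moreover have "(\<lambda>x. f (A x + b)) differentiable (at x)" if "x \<in> S" for x
    using has_derivative_compose_affine[OF assms(1) d[OF that]] by (auto simp: differentiable_def)
  ultimately show ?case by simp
qed

lemma Cinf_on_compose_affine:
  assumes "Cinf_on T f" "bounded_linear A" "open S" "\<And>x. x \<in> S \<Longrightarrow> A x + b \<in> T"
  shows "Cinf_on S (\<lambda>x. f (A x + b))"
  unfolding Cinf_on_def
  by (intro allI Ck_on_compose_affine[OF assms(2-4)]) (use assms(1) in \<open>simp_all add: Cinf_on_def\<close>)


section \<open>Local forms\<close>

lemma length_omit: "i < length vs \<Longrightarrow> length (omit i vs) = length vs - 1"
  by (simp add: omit_def)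

lemma map_omit: "map f (omit i vs) = omit i (map f vs)"
  by (simp add: omit_def take_map drop_map)

lemma del_cong:
  assumes "open S" "p \<in> S" "\<And>q us. q \<in> S \<Longrightarrow> \<omega> q us = \<eta> q us"
  shows "del \<omega> p vs = del \<eta> p vs"
  unfolding del_def
  by (intro sum.cong refl arg_cong2[where f = "(*)"] arg_cong[where f = "\<lambda>L. part10 L _"]
      frechet_derivative_cong_open[OF assms(1,2)]) (use assms(3) in auto)

lemma del_add:
  assumes "\<And>us. (\<lambda>q. \<omega> q us) differentiable (at p)" "\<And>us. (\<lambda>q. \<eta> q us) differentiable (at p)"
  shows "del (\<lambda>q us. \<omega> q us + \<eta> q us) p vs = del \<omega> p vs + del \<eta> p vs"
  unfolding del_def sum.distrib[symmetric]
  by (intro sum.cong refl)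
    (simp only: frechet_derivative_add[OF assms], simp add: part10_def field_simps)

lemma delbar_add:
  assumes "\<And>us. (\<lambda>q. \<omega> q us) differentiable (at p)" "\<And>us. (\<lambda>q. \<eta> q us) differentiable (at p)"
  shows "delbar (\<lambda>q us. \<omega> q us + \<eta> q us) p vs = delbar \<omega> p vs + delbar \<eta> p vs"
  unfolding delbar_def sum.distrib[symmetric]
  by (intro sum.cong refl)
    (simp only: frechet_derivative_add[OF assms], simp add: part01_def field_simps)

section \<open>Complex-affine maps: derivatives and types of pulled-back forms\<close>

lemma pullback_affine:
  assumes "bounded_linear A"
  shows "pullback (\<lambda>q. A q + b) \<omega> p vs = \<omega> (A p + b) (map A vs)"
  using frechet_derivative_at[OF has_derivative_affine[OF assms]] by (simp add: pullback_def)

text \<open>The chain rule replaces the differential \<open>L\<close> of a coefficient by its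
  composition with \<open>A\<close>. Since \<open>A\<close> commutes with multiplication by \<i>,
  taking \<open>part10\<close> commutes with this composition. As \<open>A\<close> does not depend
  on the point, the vectors fed to the form stay constant and no second derivative of the map
  occurs.\<close>

lemma del_pullback_affine:
  assumes A: "bounded_linear A" "\<And>c v. A (c *s v) = c *s A v"
    and d: "\<And>us. (\<lambda>q. \<omega> q us) differentiable (at (A p + b))"
  shows "del (pullback (\<lambda>q. A q + b) \<omega>) p vs = pullback (\<lambda>q. A q + b) (del \<omega>) p vs"
  unfolding del_def pullback_affine[OF A(1)] length_map
  by (intro sum.cong refl)
    (simp add: map_omit frechet_derivative_compose_affine[OF A(1) d] part10_def A(2))

lemma delbar_pullback_affine:
  assumes A: "bounded_linear A" "\<And>c v. A (c *s v) = c *s A v"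
    and d: "\<And>us. (\<lambda>q. \<omega> q us) differentiable (at (A p + b))"
  shows "delbar (pullback (\<lambda>q. A q + b) \<omega>) p vs = pullback (\<lambda>q. A q + b) (delbar \<omega>) p vs"
  unfolding delbar_def pullback_affine[OF A(1)] length_map
  by (intro sum.cong refl)
    (simp add: map_omit frechet_derivative_compose_affine[OF A(1) d] part01_def A(2))

text \<open>Prepares the application of \<open>del\<close> to \<open>delbar \<omega>\<close>: the
  coefficients of \<open>delbar \<omega>\<close> are combinations of first directional derivatives
  of coefficients of \<open>\<omega>\<close>, which are differentiable because the latter are twice
  differentiable.\<close>

lemma differentiable_delbar:
  assumes "\<And>us. Cinf_on S (\<lambda>q. \<omega> q us)" "p \<in> S"
  shows "(\<lambda>q. delbar \<omega> q vs) differentiable (at p)"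
proof -
  have "(\<lambda>q. frechet_derivative (\<lambda>r. \<omega> r us) (at q) v) differentiable (at p)" for us v
  proof -
    have "Ck_on (Suc (Suc 0)) S (\<lambda>r. \<omega> r us)"
      using assms(1) unfolding Cinf_on_def by blast
    then show ?thesis using assms(2) by simp
  qed
  then show ?thesis
    unfolding delbar_def part01_def divide_inverse
    by (intro differentiable_sum differentiable_mult differentiable_add differentiable_const) auto
qed

text \<open>Each term of the component multiplies some slots by \<i>, and \<open>L\<close> can be
  moved past these factors.\<close>

lemma pq_component_compose:
  assumes "\<And>c v. L (c *s v) = c *s L v"
  shows "pq_component r s (\<lambda>us. B (map L us)) vs = pq_component r s B (map L vs)"
proof -
  have "map L (map (\<lambda>j. if j \<in> T then \<i> *s (vs ! j) else vs ! j) [0..<r+s]) =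
    map (\<lambda>j. if j \<in> T then \<i> *s (map L vs ! j) else map L vs ! j) [0..<r+s]"
    if "length vs = r + s" for T
    using that by (auto simp: assms)
  then show ?thesis
    by (cases "length vs = r + s") (simp_all only: pq_component_def length_map if_True if_False)
qed

lemma pq_component_add:
  "pq_component r s (\<lambda>us. B us + C us) vs = pq_component r s B vs + pq_component r s C vs"
  by (simp add: pq_component_def distrib_left sum.distrib add_divide_distrib)

lemma alternating_compose:
  fixes L :: "complex^'n::finite \<Rightarrow> complex^'m::finite"
  assumes "alternating k B" "linear L"
  shows "alternating k (\<lambda>us. B (map L us))"
  unfolding alternating_def
proof (intro conjI allI impI)
  fix vs :: "(complex^'n) list" and i assume vs: "length vs = k" "i < k"
  have "linear (\<lambda>v. B ((map L vs)[i := v]))"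
    using assms(1) vs by (simp add: alternating_def)
  from linear_compose[OF assms(2) this]
  show "linear (\<lambda>v. B (map L (vs[i := v])))" by (simp add: o_def map_update)
qed (use assms(1) in \<open>auto simp: alternating_def distinct_map\<close>)

lemma alternating_add:
  "alternating k B \<Longrightarrow> alternating k C \<Longrightarrow> alternating k (\<lambda>us. B us + C us)"
  by (simp add: alternating_def linear_compose_add)


section \<open>Forms on manifolds\<close>

lemma complex_manifold_chart:
  assumes "complex_manifold M" "c \<in> atlas M"
  shows "is_chart (mtop M) c" "open (snd c ` fst c)"
  using assms by (auto simp: complex_manifold_def is_chart_def)

lemma complex_manifold_overlap:
  assumes "complex_manifold M" "c \<in> atlas M" "c' \<in> atlas M"
  shows "open (chart_overlap c c')"
    and "p \<in> chart_overlap c c' \<Longrightarrow> transition c c' differentiable (at p)"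
proof -
  show "open (chart_overlap c c')"
    using assms complex_manifold_chart(1) open_chart_overlap by blast
  show "transition c c' differentiable (at p)" if "p \<in> chart_overlap c c'"
    using assms that unfolding complex_manifold_def holomorphic_map_on_def differentiable_def by blast
qed

lemma transition_self:
  assumes "is_chart X c" "p \<in> snd c ` fst c"
  shows "transition c c p = p"
  using assms inv_into_chart[OF assms(1)] by (auto simp: transition_def)

lemma smooth_form_differentiable:
  assumes "smooth_form M k \<omega>" "c \<in> atlas M" "p \<in> snd c ` fst c"
  shows "(\<lambda>q. \<omega> c q us) differentiable (at p)"
proof -
  have "Ck_on (Suc 0) (snd c ` fst c) (\<lambda>q. \<omega> c q us)"
    using assms unfolding smooth_form_def Cinf_on_def by blast
  then show ?thesis using assms(3) by auto
qed

lemma smooth_form_alternating: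
  "smooth_form M k \<omega> \<Longrightarrow> c \<in> atlas M \<Longrightarrow> p \<in> snd c ` fst c \<Longrightarrow> alternating k (\<omega> c p)"
  unfolding smooth_form_def by blast

lemma smooth_form_length:
  "smooth_form M k \<omega> \<Longrightarrow> c \<in> atlas M \<Longrightarrow> p \<in> snd c ` fst c \<Longrightarrow> length vs \<noteq> k \<Longrightarrow> \<omega> c p vs = 0"
  using smooth_form_alternating[of M k \<omega> c p] by (simp add: alternating_def)

lemma smooth_form_differentiable_mdelbar:
  assumes "smooth_form M k \<omega>" "c \<in> atlas M" "p \<in> snd c ` fst c"
  shows "(\<lambda>q. mdelbar \<omega> c q us) differentiable (at p)"
  unfolding mdelbar_def using assms
  by (intro differentiable_delbar[of "snd c ` fst c"]) (auto simp: smooth_form_def)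

section \<open>Sums of forms on a manifold\<close>

definition add_form :: "('a, 'n::finite) mform \<Rightarrow> ('a, 'n) mform \<Rightarrow> ('a, 'n) mform" where
  "add_form \<omega> \<eta> c = (\<lambda>p vs. \<omega> c p vs + \<eta> c p vs)"

lemma smooth_form_add:
  assumes "complex_manifold M" "smooth_form M k \<omega>" "smooth_form M k \<eta>"
  shows "smooth_form M k (add_form \<omega> \<eta>)"
  using assms complex_manifold_chart(2)[OF assms(1)]
  by (auto simp: smooth_form_def add_form_def pullback_def Cinf_on_def alternating_add Ck_on_add)

lemma mcomponent_add:
  "mcomponent r s (add_form \<omega> \<eta>) = add_form (mcomponent r s \<omega>) (mcomponent r s \<eta>)"
  by (intro ext) (simp add: mcomponent_def add_form_def pq_component_add)

lemma real_form_add: "real_form M \<omega> \<Longrightarrow> real_form M \<eta> \<Longrightarrow> real_form M (add_form \<omega> \<eta>)"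
  by (simp add: real_form_def add_form_def)

lemma real_11_form_add:
  "complex_manifold M \<Longrightarrow> real_11_form M \<omega> \<Longrightarrow> real_11_form M \<eta> \<Longrightarrow> real_11_form M (add_form \<omega> \<eta>)"
  unfolding real_11_form_def
  by (simp add: smooth_form_add real_form_add mcomponent_add) (simp add: form_eq_def add_form_def)

lemma transverse_11_form_pos:
  "transverse_11_form M \<omega> \<Longrightarrow> c \<in> atlas M \<Longrightarrow> p \<in> snd c ` fst c \<Longrightarrow> v \<noteq> 0 \<Longrightarrow>
    0 < Re (\<omega> c p [v, \<i> *s v])"
  unfolding transverse_11_form_def by blast

lemma mdel_add:
  assumes "smooth_form M k \<omega>" "smooth_form M l \<eta>"
  shows "form_eq M (mdel (add_form \<omega> \<eta>)) (add_form (mdel \<omega>) (mdel \<eta>))"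
  using assms unfolding form_eq_def mdel_def add_form_def
  by (auto intro!: del_add intro: smooth_form_differentiable)

lemma mdelbar_add:
  assumes "smooth_form M k \<omega>" "smooth_form M l \<eta>"
  shows "form_eq M (mdelbar (add_form \<omega> \<eta>)) (add_form (mdelbar \<omega>) (mdelbar \<eta>))"
  using assms unfolding form_eq_def mdelbar_def add_form_def
  by (auto intro!: delbar_add intro: smooth_form_differentiable)

lemma form_eqI:
  "(\<And>c p vs. c \<in> atlas M \<Longrightarrow> p \<in> snd c ` fst c \<Longrightarrow> \<omega> c p vs = \<eta> c p vs) \<Longrightarrow> form_eq M \<omega> \<eta>"
  and form_eqD:
  "form_eq M \<omega> \<eta> \<Longrightarrow> c \<in> atlas M \<Longrightarrow> p \<in> snd c ` fst c \<Longrightarrow> \<omega> c p vs = \<eta> c p vs"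
  unfolding form_eq_def by blast+

lemma form_eq_trans [trans]: "form_eq M \<omega> \<eta> \<Longrightarrow> form_eq M \<eta> \<theta> \<Longrightarrow> form_eq M \<omega> \<theta>"
  and form_eq_sym: "form_eq M \<omega> \<eta> \<Longrightarrow> form_eq M \<eta> \<omega>"
  by (simp_all add: form_eq_def)

lemma form_eq_add:
  "form_eq M \<omega> \<omega>' \<Longrightarrow> form_eq M \<eta> \<eta>' \<Longrightarrow> form_eq M (add_form \<omega> \<eta>) (add_form \<omega>' \<eta>')"
  by (simp add: form_eq_def add_form_def)

lemma add_form_zero [simp]: "add_form zero_form zero_form = zero_form"
  by (intro ext) (simp add: add_form_def zero_form_def)

text \<open>Lets facts about \<open>mdiff\<close> follow from those about \<open>mdel\<close> and
  \<open>mdelbar\<close>.\<close>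

lemma mdiff_eq_add: "mdiff \<omega> = add_form (mdel \<omega>) (mdelbar \<omega>)"
  by (intro ext) (simp add: mdiff_def mdel_def mdelbar_def add_form_def ext_d_eq_del_plus_delbar)

lemma mdiff_add:
  assumes "smooth_form M k \<omega>" "smooth_form M l \<eta>"
  shows "form_eq M (mdiff (add_form \<omega> \<eta>)) (add_form (mdiff \<omega>) (mdiff \<eta>))"
  using mdel_add[OF assms] mdelbar_add[OF assms]
  by (simp add: mdiff_eq_add form_eq_def add_form_def)

text \<open>Agreement on the images of charts passes to derivatives because these images are
  open.\<close>

lemma mdel_cong:
  assumes "complex_manifold M" "form_eq M \<omega> \<eta>"
  shows "form_eq M (mdel \<omega>) (mdel \<eta>)"
  unfolding mdel_def
  by (intro form_eqI del_cong[OF complex_manifold_chart(2)[OF assms(1)]] form_eqD[OF assms(2)])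

lemma mdel_mdelbar_add:
  assumes "complex_manifold M" "smooth_form M k \<omega>" "smooth_form M l \<eta>"
  shows "form_eq M (mdel (mdelbar (add_form \<omega> \<eta>))) (add_form (mdel (mdelbar \<omega>)) (mdel (mdelbar \<eta>)))"
proof -
  have "form_eq M (mdel (mdelbar (add_form \<omega> \<eta>))) (mdel (add_form (mdelbar \<omega>) (mdelbar \<eta>)))"
    by (rule mdel_cong[OF assms(1) mdelbar_add[OF assms(2,3)]])
  also have "form_eq M \<dots> (add_form (mdel (mdelbar \<omega>)) (mdel (mdelbar \<eta>)))"
    using assms(2,3) unfolding form_eq_def mdel_def add_form_def
    by (auto intro!: del_add intro: smooth_form_differentiable_mdelbar)
  finally show ?thesis .
qed

section \<open>The zero form and degrees\<close>

lemma smooth_zero_form: "complex_manifold M \<Longrightarrow> smooth_form M k zero_form"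
  using complex_manifold_chart(2)[of M]
  by (auto simp: smooth_form_def zero_form_def alternating_def pullback_def Cinf_on_def
      Ck_on_const linear_zero)

lemma del_zero [simp]: "del (\<lambda>p vs. 0) = (\<lambda>p vs. 0)"
  and delbar_zero [simp]: "delbar (\<lambda>p vs. 0) = (\<lambda>p vs. 0)"
  by (intro ext; simp add: del_def delbar_def part10_def part01_def)+

lemma mdel_zero [simp]: "mdel zero_form = zero_form"
  and mdelbar_zero [simp]: "mdelbar zero_form = zero_form"
  by (intro ext; simp add: mdel_def mdelbar_def zero_form_def[abs_def])+

text \<open>Omitting an entry from a list whose length is not \<open>Suc k\<close> leaves a list
  whose length is not \<open>k\<close>, so every differentiated coefficient vanishes on the whole
  open image of the chart. The hypothesis on \<open>\<omega>\<close> is about vanishing only, in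
  place of \<open>smooth_form\<close>, so that it can be met by
  \<open>mdelbar \<alpha>\<close>.\<close>

lemma mdel_length:
  assumes "complex_manifold M" "c \<in> atlas M" "p \<in> snd c ` fst c" "length vs \<noteq> Suc k"
    and "\<And>q us. q \<in> snd c ` fst c \<Longrightarrow> length us \<noteq> k \<Longrightarrow> \<omega> c q us = 0"
  shows "mdel \<omega> c p vs = 0"
proof -
  have "frechet_derivative (\<lambda>q. \<omega> c q (omit i vs)) (at p) = (\<lambda>v. 0)" if "i < length vs" for i
  proof -
    have "frechet_derivative (\<lambda>q. \<omega> c q (omit i vs)) (at p) = frechet_derivative (\<lambda>q. 0) (at p)"
      by (rule frechet_derivative_cong_open[OF complex_manifold_chart(2)[OF assms(1,2)] assms(3)])
        (use that assms(4) in \<open>auto simp: length_omit intro!: assms(5)\<close>)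
    then show ?thesis by simp
  qed
  then show ?thesis by (simp add: mdel_def del_def part10_def)
qed

lemma mdelbar_length:
  assumes "complex_manifold M" "c \<in> atlas M" "p \<in> snd c ` fst c" "length vs \<noteq> Suc k"
    and "\<And>q us. q \<in> snd c ` fst c \<Longrightarrow> length us \<noteq> k \<Longrightarrow> \<omega> c q us = 0"
  shows "mdelbar \<omega> c p vs = 0"
proof -
  have "frechet_derivative (\<lambda>q. \<omega> c q (omit i vs)) (at p) = (\<lambda>v. 0)" if "i < length vs" for i
  proof -
    have "frechet_derivative (\<lambda>q. \<omega> c q (omit i vs)) (at p) = frechet_derivative (\<lambda>q. 0) (at p)"
      by (rule frechet_derivative_cong_open[OF complex_manifold_chart(2)[OF assms(1,2)] assms(3)])
        (use that assms(4) in \<open>auto simp: length_omit intro!: assms(5)\<close>)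
    then show ?thesis by simp
  qed
  then show ?thesis by (simp add: mdelbar_def delbar_def part01_def)
qed

text \<open>Type WK allows a potential of any degree. Since \<open>\<partial>\<omega>\<close> has degree 3, a potential of degree
  other than 1 can be replaced by 0; so the potentials on two factors can be added.\<close>

lemma type_WK_potential_degree_1:
  assumes "complex_manifold M" "smooth_form M 2 \<omega>" "smooth_form M k \<alpha>"
    and eq: "form_eq M (mdel \<omega>) (mdel (mdelbar \<alpha>))"
  shows "\<exists>\<beta>. smooth_form M 1 \<beta> \<and> form_eq M (mdel \<omega>) (mdel (mdelbar \<beta>))"
proof (cases "k = 1")
  case True
  then show ?thesis using assms by auto
next
  case False
  \<comment> \<open>On lists of length 3 the equation \<open>eq\<close> is used: its right side
    lives in degree \<open>k + 2\<close>, which is not 3. On other lists the degree 2 of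
    \<open>\<omega>\<close> suffices.\<close>
  have "mdel \<omega> c p vs = 0" if c: "c \<in> atlas M" and p: "p \<in> snd c ` fst c" for c p vs
  proof (cases "length vs = 3")
    case True
    have "mdel (mdelbar \<alpha>) c p vs = 0"
      by (rule mdel_length[OF assms(1) c p, of _ "Suc k"])
        (use True False in \<open>auto intro!: mdelbar_length[OF assms(1) c, of _ _ k]
          intro: smooth_form_length[OF assms(3) c]\<close>)
    then show ?thesis using eq c p unfolding form_eq_def by metis
  next
    case False
    then show ?thesis
      by (intro mdel_length[OF assms(1) c p, of _ 2]) (auto intro: smooth_form_length[OF assms(2) c])
  qed
  then have "form_eq M (mdel \<omega>) (mdel (mdelbar zero_form))"
    by (simp add: form_eq_def zero_form_def)
  then show ?thesis using smooth_zero_form[OF assms(1)] by blast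
qed


section \<open>Pullback along maps that are affine in charts\<close>

text \<open>The chart \<open>\<kappa> c\<close> of \<open>N\<close> contains the image of the chart \<open>c\<close>, and the map \<open>M \<rightarrow> N\<close> reads
  \<open>p \<mapsto> A p + b\<close> in these two charts. Charts with empty domain are exempt from the first condition
  on \<open>\<kappa>\<close> because a product chart with empty domain does not determine its factors.\<close>

locale affine_chart_map =
  fixes M :: "('a, 'n::finite) cmfd" and N :: "('b, 'm::finite) cmfd"
    and \<kappa> :: "('a, 'n) chart \<Rightarrow> ('b, 'm) chart"
    and A :: "complex^'n \<Rightarrow> complex^'m" and b :: "complex^'m"
  assumes M: "complex_manifold M" and N: "complex_manifold N"
    and linear_A: "linear A" and scale_A: "A (s *s v) = s *s A v"
    and chart: "c \<in> atlas M \<Longrightarrow> fst c \<noteq> {} \<Longrightarrow> \<kappa> c \<in> atlas N"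
    and image: "c \<in> atlas M \<Longrightarrow> p \<in> snd c ` fst c \<Longrightarrow> A p + b \<in> snd (\<kappa> c) ` fst (\<kappa> c)"
    and overlap: "c \<in> atlas M \<Longrightarrow> c' \<in> atlas M \<Longrightarrow> p \<in> chart_overlap c c' \<Longrightarrow>
      A p + b \<in> chart_overlap (\<kappa> c) (\<kappa> c')"
    and trans: "c \<in> atlas M \<Longrightarrow> c' \<in> atlas M \<Longrightarrow> p \<in> chart_overlap c c' \<Longrightarrow>
      A (transition c c' p) + b = transition (\<kappa> c) (\<kappa> c') (A p + b)"
begin

section \<open>Naturality of the operators and conditions under \<open>mpullback\<close>\<close>

lemma bounded_linear_A: "bounded_linear A"
  using linear_A linear_conv_bounded_linear by blast

definition mpullback :: "('b, 'm) mform \<Rightarrow> ('a, 'n) mform" where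
  "mpullback \<omega> c = pullback (\<lambda>p. A p + b) (\<omega> (\<kappa> c))"

lemma mpullback_eq: "mpullback \<omega> c p vs = \<omega> (\<kappa> c) (A p + b) (map A vs)"
  by (simp add: mpullback_def pullback_affine[OF bounded_linear_A])

lemma chart': "c \<in> atlas M \<Longrightarrow> p \<in> snd c ` fst c \<Longrightarrow> \<kappa> c \<in> atlas N"
  using chart by blast

text \<open>By \<open>trans\<close>, following the transition map by the affine map gives the same
  function on the open overlap as the opposite order; the two sides are its derivative computed in
  both ways. This makes pulled-back local forms compatible between charts.\<close>

lemma frechet_derivative_transition:
  assumes c: "c \<in> atlas M" "c' \<in> atlas M" "p \<in> chart_overlap c c'"
  shows "A (frechet_derivative (transition c c') (at p) v) =
    frechet_derivative (transition (\<kappa> c) (\<kappa> c')) (at (A p + b)) (A v)"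
proof -
  have ne: "fst c \<noteq> {}" "fst c' \<noteq> {}"
    using c(3) by (auto simp: chart_overlap_def)
  let ?t = "transition c c'" and ?t' = "transition (\<kappa> c) (\<kappa> c')"
  have t: "(?t has_derivative frechet_derivative ?t (at p)) (at p)"
    using complex_manifold_overlap(2)[OF M c] by (simp add: frechet_derivative_works)
  have "?t' differentiable (at (A p + b))"
    using complex_manifold_overlap(2)[OF N chart[OF c(1) ne(1)] chart[OF c(2) ne(2)] overlap[OF c]] .
  from has_derivative_compose_affine[OF bounded_linear_A this]
  have "((\<lambda>q. A (?t q) + b) has_derivative
      (\<lambda>v. frechet_derivative ?t' (at (A p + b)) (A v))) (at p)"
    by (rule has_derivative_transform_within_open[OF _ complex_manifold_overlap(1)[OF M c(1,2)] c(3)])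
      (simp add: trans c)
  moreover have "((\<lambda>q. A (?t q) + b) has_derivative
      (\<lambda>v. A (frechet_derivative ?t (at p) v))) (at p)"
    using has_derivative_compose[OF t has_derivative_affine[OF bounded_linear_A]] .
  ultimately have "(\<lambda>v. A (frechet_derivative ?t (at p) v)) =
      (\<lambda>v. frechet_derivative ?t' (at (A p + b)) (A v))"
    by (intro has_derivative_unique)
  then show ?thesis by (rule fun_cong)
qed

lemma smooth_mpullback:
  assumes "smooth_form N k \<omega>"
  shows "smooth_form M k (mpullback \<omega>)"
  unfolding smooth_form_def
proof (intro conjI ballI allI)
  fix c p assume "c \<in> atlas M" "p \<in> snd c ` fst c"
  then have "alternating k (\<omega> (\<kappa> c) (A p + b))"
    by (intro smooth_form_alternating[OF assms] chart' image)
  from alternating_compose[OF this linear_A]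
  show "alternating k (mpullback \<omega> c p)" by (simp add: mpullback_eq[abs_def])
next
  fix c vs assume c: "c \<in> atlas M"
  show "Cinf_on (snd c ` fst c) (\<lambda>p. mpullback \<omega> c p vs)"
  \<comment> \<open>For an empty domain \<open>\<kappa> c\<close> may lie outside the atlas of
    \<open>N\<close>, but smoothness on the empty set is vacuous.\<close>
  proof (cases "fst c = {}")
    case True
    have "Ck_on k {} f" for k and f :: "complex^'n \<Rightarrow> complex"
      by (induction k arbitrary: f) auto
    then show ?thesis using True by (simp add: Cinf_on_def)
  next
    case False
    have "Cinf_on (snd (\<kappa> c) ` fst (\<kappa> c)) (\<lambda>q. \<omega> (\<kappa> c) q (map A vs))"
      using assms chart[OF c False] by (simp add: smooth_form_def)
    then show ?thesis
      unfolding mpullback_eq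
      by (rule Cinf_on_compose_affine[OF _ bounded_linear_A complex_manifold_chart(2)[OF M c]])
        (rule image[OF c])
  qed
next
  fix c c' p vs assume c: "c \<in> atlas M" "c' \<in> atlas M" "p \<in> chart_overlap c c'"
  then have ne: "fst c \<noteq> {}" "fst c' \<noteq> {}"
    by (auto simp: chart_overlap_def)
  \<comment> \<open>First the compatibility of \<open>\<omega>\<close> between
    \<open>\<kappa> c\<close> and \<open>\<kappa> c'\<close>, then the interchange of
    \<open>A\<close> with the differentials of the transition maps.\<close>
  have "mpullback \<omega> c p vs =
      pullback (transition (\<kappa> c) (\<kappa> c')) (\<omega> (\<kappa> c')) (A p + b) (map A vs)"
    using assms overlap[OF c] chart[OF c(1) ne(1)] chart[OF c(2) ne(2)]
    by (simp add: smooth_form_def mpullback_eq)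
  also have "\<dots> = pullback (transition c c') (mpullback \<omega> c') p vs"
    by (simp add: pullback_def mpullback_eq trans c frechet_derivative_transition o_def)
  finally show "mpullback \<omega> c p vs = pullback (transition c c') (mpullback \<omega> c') p vs" .
qed

lemma form_eq_mpullback: "form_eq N \<omega> \<eta> \<Longrightarrow> form_eq M (mpullback \<omega>) (mpullback \<eta>)"
  by (intro form_eqI) (auto simp only: mpullback_eq intro: form_eqD chart' image)

lemma mpullback_zero [simp]: "mpullback zero_form = zero_form"
  by (intro ext) (simp add: mpullback_eq zero_form_def)

lemma mpullback_add: "mpullback (add_form \<omega> \<eta>) = add_form (mpullback \<omega>) (mpullback \<eta>)"
  by (intro ext) (simp add: mpullback_eq add_form_def)

lemma mcomponent_mpullback: "mcomponent r s (mpullback \<omega>) = mpullback (mcomponent r s \<omega>)"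
  by (intro ext) (simp add: mcomponent_def mpullback_eq[abs_def] pq_component_compose[OF scale_A])

lemma real_mpullback: "real_form N \<omega> \<Longrightarrow> real_form M (mpullback \<omega>)"
  unfolding real_form_def mpullback_eq by (blast dest: image chart')

lemma real_11_mpullback: "real_11_form N \<omega> \<Longrightarrow> real_11_form M (mpullback \<omega>)"
  unfolding real_11_form_def
  by (simp add: smooth_mpullback real_mpullback mcomponent_mpullback form_eq_mpullback)

text \<open>Since \<open>A\<close> commutes with \<i>, positivity at \<open>v\<close> is positivity
  of \<open>\<omega>\<close> at \<open>A v\<close>, which must be nonzero. This serves the slices;
  the projections have kernels and are treated in \<open>transverse_box_sum\<close>.\<close>

lemma transverse_mpullback:
  assumes "transverse_11_form N \<omega>" "\<And>v. v \<noteq> 0 \<Longrightarrow> A v \<noteq> 0"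
  shows "transverse_11_form M (mpullback \<omega>)"
  unfolding transverse_11_form_def
proof (intro conjI ballI allI impI)
  show "real_11_form M (mpullback \<omega>)"
    using assms(1) real_11_mpullback by (simp add: transverse_11_form_def)
  fix c p and v :: "complex^'n" assume "c \<in> atlas M" "p \<in> snd c ` fst c" "v \<noteq> 0"
  then have "0 < Re (\<omega> (\<kappa> c) (A p + b) [A v, \<i> *s A v])"
    by (intro transverse_11_form_pos[OF assms(1)] chart' image assms(2))
  then show "0 < Re (mpullback \<omega> c p [v, \<i> *s v])" by (simp add: mpullback_eq scale_A)
qed

lemma mdel_mpullback:
  assumes "smooth_form N k \<omega>"
  shows "form_eq M (mdel (mpullback \<omega>)) (mpullback (mdel \<omega>))"
  unfolding mdel_def mpullback_def
  by (intro form_eqI del_pullback_affine[OF bounded_linear_A scale_A]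
      smooth_form_differentiable[OF assms] chart' image)

lemma mdelbar_mpullback:
  assumes "smooth_form N k \<omega>"
  shows "form_eq M (mdelbar (mpullback \<omega>)) (mpullback (mdelbar \<omega>))"
  unfolding mdelbar_def mpullback_def
  by (intro form_eqI delbar_pullback_affine[OF bounded_linear_A scale_A]
      smooth_form_differentiable[OF assms] chart' image)

lemma mdiff_mpullback:
  assumes "smooth_form N k \<omega>"
  shows "form_eq M (mdiff (mpullback \<omega>)) (mpullback (mdiff \<omega>))"
  unfolding mdiff_eq_add mpullback_add
  by (rule form_eq_add[OF mdel_mpullback[OF assms] mdelbar_mpullback[OF assms]])

lemma mdel_mdelbar_mpullback:
  assumes "smooth_form N k \<omega>"
  shows "form_eq M (mdel (mdelbar (mpullback \<omega>))) (mpullback (mdel (mdelbar \<omega>)))"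
proof -
  have "form_eq M (mdel (mdelbar (mpullback \<omega>))) (mdel (mpullback (mdelbar \<omega>)))"
    by (rule mdel_cong[OF M mdelbar_mpullback[OF assms]])
  \<comment> \<open>The local lemma is applied directly to \<open>mdelbar \<omega>\<close>, using
    the differentiability of its coefficients.\<close>
  also have "form_eq M \<dots> (mpullback (mdel (mdelbar \<omega>)))"
    unfolding mdel_def mpullback_def
    by (intro form_eqI del_pullback_affine[OF bounded_linear_A scale_A]
        smooth_form_differentiable_mdelbar[OF assms] chart' image)
  finally show ?thesis .
qed

text \<open>Each defining condition is built from operations that commute with pullback; injectivity
  of \<open>A\<close> enters through transversality.\<close>

lemma generalized_1_kahler_mpullback:
  assumes inj: "\<And>v. v \<noteq> 0 \<Longrightarrow> A v \<noteq> 0" and "generalized_1_kahler \<T> N"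
  shows "generalized_1_kahler \<T> M"
proof -
  have transverse: "transverse_11_form M (mpullback \<omega>)" if "transverse_11_form N \<omega>" for \<omega>
    using transverse_mpullback that inj by blast
  show ?thesis
  proof (cases \<T>)
    case Type_K
    then obtain \<omega> where w: "transverse_11_form N \<omega>" "form_eq N (mdiff \<omega>) zero_form"
      using assms(2) by auto
    then have "smooth_form N 2 \<omega>" by (simp add: transverse_11_form_def real_11_form_def)
    from form_eq_trans[OF mdiff_mpullback[OF this] form_eq_mpullback[OF w(2)]]
    show ?thesis
      using transverse[OF w(1)] unfolding Type_K generalized_1_kahler.simps mpullback_zero by blast
  next
    case Type_WK
    then obtain \<omega> k \<alpha> where w: "transverse_11_form N \<omega>" "smooth_form N k \<alpha>"
        "form_eq N (mdel \<omega>) (mdel (mdelbar \<alpha>))"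
      using assms(2) by auto
    then have "smooth_form N 2 \<omega>" by (simp add: transverse_11_form_def real_11_form_def)
    \<comment> \<open>The pullback of \<open>\<alpha>\<close> is the new potential: pull the
      equation back, then move the pullback inside the operators on both sides.\<close>
    from form_eq_trans[OF form_eq_trans[OF mdel_mpullback[OF this] form_eq_mpullback[OF w(3)]]
        form_eq_sym[OF mdel_mdelbar_mpullback[OF w(2)]]]
    show ?thesis
      using transverse[OF w(1)] smooth_mpullback[OF w(2)]
      unfolding Type_WK generalized_1_kahler.simps by blast
  next
    case Type_S
    then obtain \<Psi> where w: "smooth_form N 2 \<Psi>" "real_form N \<Psi>" "form_eq N (mdiff \<Psi>) zero_form"
        "transverse_11_form N (mcomponent 1 1 \<Psi>)"
      using assms(2) by auto
    from form_eq_trans[OF mdiff_mpullback[OF w(1)] form_eq_mpullback[OF w(3)]]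
    have "form_eq M (mdiff (mpullback \<Psi>)) zero_form" by simp
    then show ?thesis
      using transverse[OF w(4)] smooth_mpullback[OF w(1)] real_mpullback[OF w(2)]
      unfolding Type_S generalized_1_kahler.simps mcomponent_mpullback[symmetric] by blast
  next
    case Type_PL
    then obtain \<omega> where w: "transverse_11_form N \<omega>" "form_eq N (mdel (mdelbar \<omega>)) zero_form"
      using assms(2) by auto
    then have "smooth_form N 2 \<omega>" by (simp add: transverse_11_form_def real_11_form_def)
    from form_eq_trans[OF mdel_mdelbar_mpullback[OF this] form_eq_mpullback[OF w(2)]]
    show ?thesis
      using transverse[OF w(1)] unfolding Type_PL generalized_1_kahler.simps mpullback_zero by blast
  qed
qed

end


section \<open>Slices and projections\<close>

lemma atlas_prodE:
  assumes "C \<in> atlas (X \<times>\<^sub>M\<^sub>f Y)"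
  obtains c c' where "C = prod_chart c c'" "c \<in> atlas X" "c' \<in> atlas Y"
  using assms by (auto simp: prod_cmfd_def)

lemma prod_chart_in_atlas:
  "c \<in> atlas X \<Longrightarrow> c' \<in> atlas Y \<Longrightarrow> prod_chart c c' \<in> atlas (X \<times>\<^sub>M\<^sub>f Y)"
  unfolding prod_cmfd_def cmfd.simps by blast

lemma image_prod_chart:
  "snd (prod_chart c c') ` fst (prod_chart c c') =
     (\<lambda>z. join_vec (fst z) (snd z)) ` (snd c ` fst c \<times> snd c' ` fst c')"
  by (force simp: prod_chart_def)

lemma join_vec_in_image_prod_chart:
  "x \<in> snd c ` fst c \<Longrightarrow> y \<in> snd c' ` fst c' \<Longrightarrow>
    join_vec x y \<in> snd (prod_chart c c') ` fst (prod_chart c c')"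
  unfolding image_prod_chart by (intro image_eqI[of _ _ "(x, y)"]) auto

lemma join_vec_in_chart_overlap:
  "x \<in> chart_overlap c1 c2 \<Longrightarrow> y \<in> chart_overlap c1' c2' \<Longrightarrow>
    join_vec x y \<in> chart_overlap (prod_chart c1 c1') (prod_chart c2 c2')"
  unfolding chart_overlap_prod_chart by (intro image_eqI[of _ _ "(x, y)"]) auto

lemma join_vec_add: "join_vec x y + join_vec x' y' = join_vec (x + x') (y + y')"
  by (simp add: join_vec_def vec_eq_iff split: sum.split)

lemma join_vec_zero [simp]: "join_vec 0 0 = 0"
  by (simp add: join_vec_def vec_eq_iff split: sum.split)

lemma left_vec_scale: "left_vec (s *s v) = s *s left_vec v"
  and right_vec_scale: "right_vec (s *s v) = s *s right_vec v"
  by (simp_all add: left_vec_def right_vec_def vec_eq_iff)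

lemma linear_join_left: "linear (\<lambda>v. join_vec v 0)" and linear_join_right: "linear (join_vec 0)"
  by (intro linearI; simp add: join_vec_def vec_eq_iff split: sum.split)+

text \<open>The inclusion of the slice over the point of \<open>Y\<close> with coordinate
  \<open>q\<close> in \<open>c'\<close>. The same \<open>c'\<close> is the second factor of every
  target chart, so a change of charts acts there by \<open>transition c' c'\<close>, which fixes
  \<open>q\<close>.\<close>

lemma left_slice:
  assumes X: "complex_manifold X" and Y: "complex_manifold Y"
    and c': "c' \<in> atlas Y" "q \<in> snd c' ` fst c'"
  shows "affine_chart_map X (X \<times>\<^sub>M\<^sub>f Y) (\<lambda>c. prod_chart c c') (\<lambda>v. join_vec v 0) (join_vec 0 q)"
proof (rule affine_chart_map.intro)
  have q: "q \<in> chart_overlap c' c'" "transition c' c' q = q"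
    using c' transition_self[OF complex_manifold_chart(1)[OF Y c'(1)]] by (auto simp: chart_overlap_def)
  fix s v show "join_vec (s *s v) 0 = s *s join_vec v (0 :: complex^'d)"
    using join_vec_scale[of s v 0] by simp
  fix c1 c2 p assume c: "c1 \<in> atlas X" "c2 \<in> atlas X" "p \<in> chart_overlap c1 c2"
  show "join_vec p 0 + join_vec 0 q \<in> chart_overlap (prod_chart c1 c') (prod_chart c2 c')"
    using c(3) q(1) by (simp add: join_vec_in_chart_overlap join_vec_add)
  show "join_vec (transition c1 c2 p) 0 + join_vec 0 q =
      transition (prod_chart c1 c') (prod_chart c2 c') (join_vec p 0 + join_vec 0 q)"
    using transition_prod_chart[OF complex_manifold_chart(1)[OF X c(1)]
        complex_manifold_chart(1)[OF X c(2)] complex_manifold_chart(1)[OF Y c'(1)]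
        complex_manifold_chart(1)[OF Y c'(1)] c(3) q(1)] q(2)
    by (simp add: join_vec_add)
qed (use assms in \<open>simp_all add: complex_manifold_prod_cmfd prod_chart_in_atlas
    join_vec_in_image_prod_chart join_vec_add linear_join_left\<close>)

lemma right_slice:
  assumes X: "complex_manifold X" and Y: "complex_manifold Y"
    and c: "c \<in> atlas X" "q \<in> snd c ` fst c"
  shows "affine_chart_map Y (X \<times>\<^sub>M\<^sub>f Y) (prod_chart c) (join_vec 0) (join_vec q 0)"
proof (rule affine_chart_map.intro)
  have q: "q \<in> chart_overlap c c" "transition c c q = q"
    using c transition_self[OF complex_manifold_chart(1)[OF X c(1)]] by (auto simp: chart_overlap_def)
  fix s v show "join_vec 0 (s *s v) = s *s join_vec (0 :: complex^'b) v"
    using join_vec_scale[of s 0 v] by simp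
  fix c1 c2 p assume c': "c1 \<in> atlas Y" "c2 \<in> atlas Y" "p \<in> chart_overlap c1 c2"
  show "join_vec 0 p + join_vec q 0 \<in> chart_overlap (prod_chart c c1) (prod_chart c c2)"
    using c'(3) q(1) by (simp add: join_vec_in_chart_overlap join_vec_add)
  show "join_vec 0 (transition c1 c2 p) + join_vec q 0 =
      transition (prod_chart c c1) (prod_chart c c2) (join_vec 0 p + join_vec q 0)"
    using transition_prod_chart[OF complex_manifold_chart(1)[OF X c(1)]
        complex_manifold_chart(1)[OF X c(1)] complex_manifold_chart(1)[OF Y c'(1)]
        complex_manifold_chart(1)[OF Y c'(2)] q(1) c'(3)] q(2)
    by (simp add: join_vec_add)
qed (use assms in \<open>simp_all add: complex_manifold_prod_cmfd prod_chart_in_atlas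
    join_vec_in_image_prod_chart join_vec_add linear_join_right\<close>)

section \<open>The two projections of a product\<close>

text \<open>In a product chart, half of the coordinates do not depend on the component set to
  \<open>undefined\<close>.\<close>

definition left_chart :: "('a \<times> 'b, 'n::finite + 'm::finite) chart \<Rightarrow> ('a, 'n) chart" where
  "left_chart C = (fst ` fst C, \<lambda>x. left_vec (snd C (x, undefined)))"

definition right_chart :: "('a \<times> 'b, 'n::finite + 'm::finite) chart \<Rightarrow> ('b, 'm) chart" where
  "right_chart C = (snd ` fst C, \<lambda>y. right_vec (snd C (undefined, y)))"

text \<open>Membership in the atlas requires equality of pairs, hence of the coordinate maps on the
  whole type. The domain is recovered by projecting a product of sets, which fails if the other
  factor is empty.\<close>

lemma left_chart_prod: "fst c' \<noteq> {} \<Longrightarrow> left_chart (prod_chart c c') = c"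
  and right_chart_prod: "fst c \<noteq> {} \<Longrightarrow> right_chart (prod_chart c c') = c'"
  by (simp_all add: left_chart_def right_chart_def prod_chart_def)

lemma
  assumes X: "complex_manifold X" and Y: "complex_manifold Y"
  shows left_projection: "affine_chart_map (X \<times>\<^sub>M\<^sub>f Y) X left_chart left_vec 0" (is ?L)
    and right_projection: "affine_chart_map (X \<times>\<^sub>M\<^sub>f Y) Y right_chart right_vec 0" (is ?R)
proof -
  let ?P = "X \<times>\<^sub>M\<^sub>f Y"
  have chart: "left_chart C \<in> atlas X \<and> right_chart C \<in> atlas Y"
    if C: "C \<in> atlas ?P" "fst C \<noteq> {}" for C
  proof -
    obtain c c' where "C = prod_chart c c'" "c \<in> atlas X" "c' \<in> atlas Y"
      using atlas_prodE[OF C(1)] .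
    moreover from this have "fst c \<noteq> {}" "fst c' \<noteq> {}"
      using C(2) by (auto simp: prod_chart_def)
    ultimately show ?thesis by (simp add: left_chart_prod right_chart_prod)
  qed
  have image: "left_vec p \<in> snd (left_chart C) ` fst (left_chart C) \<and>
      right_vec p \<in> snd (right_chart C) ` fst (right_chart C)"
    if C: "C \<in> atlas ?P" and p: "p \<in> snd C ` fst C" for C p
  proof -
    obtain c c' where cc: "C = prod_chart c c'"
      using atlas_prodE[OF C] .
    moreover from this have "fst c \<noteq> {}" "fst c' \<noteq> {}"
      using p by (auto simp: prod_chart_def)
    ultimately show ?thesis
      using p unfolding cc image_prod_chart by (auto simp: left_chart_prod right_chart_prod)
  qed
  have trans: "left_vec p \<in> chart_overlap (left_chart C) (left_chart C') \<and>
      left_vec (transition C C' p) = transition (left_chart C) (left_chart C') (left_vec p) \<and>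
      right_vec p \<in> chart_overlap (right_chart C) (right_chart C') \<and>
      right_vec (transition C C' p) = transition (right_chart C) (right_chart C') (right_vec p)"
    if C: "C \<in> atlas ?P" "C' \<in> atlas ?P" and p: "p \<in> chart_overlap C C'" for C C' p
  proof -
    obtain c1 c1' where c1: "C = prod_chart c1 c1'" "c1 \<in> atlas X" "c1' \<in> atlas Y"
      using atlas_prodE[OF C(1)] .
    obtain c2 c2' where c2: "C' = prod_chart c2 c2'" "c2 \<in> atlas X" "c2' \<in> atlas Y"
      using atlas_prodE[OF C(2)] .
    obtain x y where xy: "p = join_vec x y" "x \<in> chart_overlap c1 c2" "y \<in> chart_overlap c1' c2'"
      using p unfolding c1 c2 chart_overlap_prod_chart by auto
    \<comment> \<open>A point of the overlap makes the domains of all four factor charts nonempty,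
      so \<open>left_chart\<close> and \<open>right_chart\<close> recover them.\<close>
    then have "fst c1 \<noteq> {}" "fst c1' \<noteq> {}" "fst c2 \<noteq> {}" "fst c2' \<noteq> {}"
      by (auto simp: chart_overlap_def)
    moreover have "transition C C' p = join_vec (transition c1 c2 x) (transition c1' c2' y)"
      unfolding c1 c2 xy(1)
      by (rule transition_prod_chart[OF _ _ _ _ xy(2,3)])
        (use X Y c1 c2 complex_manifold_chart(1) in blast)+
    ultimately show ?thesis
      using xy by (simp add: c1(1) c2(1) left_chart_prod right_chart_prod)
  qed
  show ?L
    by (rule affine_chart_map.intro)
      (use chart image trans X Y in \<open>auto simp: complex_manifold_prod_cmfd linear_left_vec left_vec_scale\<close>)
  show ?R
    by (rule affine_chart_map.intro)
      (use chart image trans X Y in \<open>auto simp: complex_manifold_prod_cmfd linear_right_vec right_vec_scale\<close>)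
qed

section \<open>External sums of forms on the two factors\<close>

locale complex_manifold_pair =
  fixes X :: "('a, 'n::finite) cmfd" and Y :: "('b, 'm::finite) cmfd"
  assumes X: "complex_manifold X" and Y: "complex_manifold Y"
begin

sublocale L: affine_chart_map "X \<times>\<^sub>M\<^sub>f Y" X left_chart left_vec 0
  by (rule left_projection[OF X Y])

sublocale R: affine_chart_map "X \<times>\<^sub>M\<^sub>f Y" Y right_chart right_vec 0
  by (rule right_projection[OF X Y])

abbreviation box_sum (infixl \<open>\<boxplus>\<close> 65) where
  "\<omega> \<boxplus> \<eta> \<equiv> add_form (L.mpullback \<omega>) (R.mpullback \<eta>)"

lemma smooth_box_sum:
  "smooth_form X k \<omega> \<Longrightarrow> smooth_form Y k \<eta> \<Longrightarrow> smooth_form (X \<times>\<^sub>M\<^sub>f Y) k (\<omega> \<boxplus> \<eta>)"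
  by (intro smooth_form_add L.M L.smooth_mpullback R.smooth_mpullback)

text \<open>Each summand alone is only semipositive, since it vanishes on vectors tangent to the
  other factor. A nonzero \<open>v\<close> has a nonzero component, whose summand is positive, while
  the other summand is at least 0.\<close>

lemma transverse_box_sum:
  assumes "transverse_11_form X \<omega>" "transverse_11_form Y \<eta>"
  shows "transverse_11_form (X \<times>\<^sub>M\<^sub>f Y) (\<omega> \<boxplus> \<eta>)"
  unfolding transverse_11_form_def
proof (intro conjI ballI allI impI)
  show "real_11_form (X \<times>\<^sub>M\<^sub>f Y) (\<omega> \<boxplus> \<eta>)"
    using assms unfolding transverse_11_form_def
    by (intro real_11_form_add L.M L.real_11_mpullback R.real_11_mpullback) auto
  fix C p and v :: "complex^('n + 'm)"
  assume C: "C \<in> atlas (X \<times>\<^sub>M\<^sub>f Y)" "p \<in> snd C ` fst C" and "v \<noteq> 0"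
  \<comment> \<open>The list \<open>[0, 0]\<close> is not distinct, so alternating covectors vanish
    on it; this covers a zero component of \<open>v\<close>.\<close>
  have w: "\<omega> (left_chart C) (left_vec p) [0, 0] = 0" "\<eta> (right_chart C) (right_vec p) [0, 0] = 0"
    using assms L.image[OF C] R.image[OF C] L.chart'[OF C] R.chart'[OF C]
    by (auto simp: transverse_11_form_def real_11_form_def smooth_form_def alternating_def)
  have l: "left_vec v \<noteq> 0 \<Longrightarrow> 0 < Re (\<omega> (left_chart C) (left_vec p) [left_vec v, \<i> *s left_vec v])"
    by (intro transverse_11_form_pos[OF assms(1)] L.image[OF C, simplified] L.chart'[OF C])
  have r: "right_vec v \<noteq> 0 \<Longrightarrow>
      0 < Re (\<eta> (right_chart C) (right_vec p) [right_vec v, \<i> *s right_vec v])"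
    by (intro transverse_11_form_pos[OF assms(2)] R.image[OF C, simplified] R.chart'[OF C])
  have "left_vec v \<noteq> 0 \<or> right_vec v \<noteq> 0"
    using \<open>v \<noteq> 0\<close> by (metis join_left_right join_vec_zero)
  then show "0 < Re ((\<omega> \<boxplus> \<eta>) C p [v, \<i> *s v])"
    using l r w \<open>left_vec v \<noteq> 0 \<or> right_vec v \<noteq> 0\<close>
    by (cases "left_vec v = 0"; cases "right_vec v = 0")
      (auto simp: add_form_def L.mpullback_eq R.mpullback_eq left_vec_scale right_vec_scale)
qed

lemma mdel_box_sum:
  assumes "smooth_form X k \<omega>" "smooth_form Y l \<eta>"
  shows "form_eq (X \<times>\<^sub>M\<^sub>f Y) (mdel (\<omega> \<boxplus> \<eta>)) (mdel \<omega> \<boxplus> mdel \<eta>)"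
  using form_eq_trans[OF mdel_add form_eq_add[OF L.mdel_mpullback R.mdel_mpullback]]
    L.smooth_mpullback R.smooth_mpullback assms by blast

lemma mdiff_box_sum:
  assumes "smooth_form X k \<omega>" "smooth_form Y l \<eta>"
  shows "form_eq (X \<times>\<^sub>M\<^sub>f Y) (mdiff (\<omega> \<boxplus> \<eta>)) (mdiff \<omega> \<boxplus> mdiff \<eta>)"
  using form_eq_trans[OF mdiff_add form_eq_add[OF L.mdiff_mpullback R.mdiff_mpullback]]
    L.smooth_mpullback R.smooth_mpullback assms by blast

lemma mdel_mdelbar_box_sum:
  assumes "smooth_form X k \<omega>" "smooth_form Y l \<eta>"
  shows "form_eq (X \<times>\<^sub>M\<^sub>f Y) (mdel (mdelbar (\<omega> \<boxplus> \<eta>))) (mdel (mdelbar \<omega>) \<boxplus> mdel (mdelbar \<eta>))"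
  using form_eq_trans[OF mdel_mdelbar_add
      form_eq_add[OF L.mdel_mdelbar_mpullback R.mdel_mdelbar_mpullback]]
    L.M L.smooth_mpullback R.smooth_mpullback assms by blast

lemma form_eq_box_sum:
  "form_eq X \<omega> \<omega>' \<Longrightarrow> form_eq Y \<eta> \<eta>' \<Longrightarrow> form_eq (X \<times>\<^sub>M\<^sub>f Y) (\<omega> \<boxplus> \<eta>) (\<omega>' \<boxplus> \<eta>')"
  by (intro form_eq_add L.form_eq_mpullback R.form_eq_mpullback)

lemma generalized_1_kahler_prod:
  assumes "generalized_1_kahler \<T> X" "generalized_1_kahler \<T> Y"
  shows "generalized_1_kahler \<T> (X \<times>\<^sub>M\<^sub>f Y)"
proof (cases \<T>)
  case Type_K
  then obtain \<omega> \<eta> where w: "transverse_11_form X \<omega>" "form_eq X (mdiff \<omega>) zero_form"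
      "transverse_11_form Y \<eta>" "form_eq Y (mdiff \<eta>) zero_form"
    using assms by auto
  then have s: "smooth_form X 2 \<omega>" "smooth_form Y 2 \<eta>"
    by (simp_all add: transverse_11_form_def real_11_form_def)
  from form_eq_trans[OF mdiff_box_sum[OF s] form_eq_box_sum[OF w(2,4)]]
  show ?thesis
    using transverse_box_sum[OF w(1,3)]
    unfolding Type_K generalized_1_kahler.simps L.mpullback_zero R.mpullback_zero add_form_zero by blast
next
  case Type_WK
  then obtain \<omega> k \<alpha> \<eta> l \<beta> where w: "transverse_11_form X \<omega>" "smooth_form X k \<alpha>"
      "form_eq X (mdel \<omega>) (mdel (mdelbar \<alpha>))" "transverse_11_form Y \<eta>" "smooth_form Y l \<beta>"
      "form_eq Y (mdel \<eta>) (mdel (mdelbar \<beta>))"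
    using assms by auto
  then have s: "smooth_form X 2 \<omega>" "smooth_form Y 2 \<eta>"
    by (simp_all add: transverse_11_form_def real_11_form_def)
  \<comment> \<open>The given potentials may have different degrees \<open>k\<close> and
    \<open>l\<close>; both are brought to degree 1 so that their external sum is a form.\<close>
  obtain \<alpha>' \<beta>' where a: "smooth_form X 1 \<alpha>'" "form_eq X (mdel \<omega>) (mdel (mdelbar \<alpha>'))"
      "smooth_form Y 1 \<beta>'" "form_eq Y (mdel \<eta>) (mdel (mdelbar \<beta>'))"
    using type_WK_potential_degree_1[OF X s(1) w(2,3)] type_WK_potential_degree_1[OF Y s(2) w(5,6)]
    by blast
  from form_eq_trans[OF form_eq_trans[OF mdel_box_sum[OF s] form_eq_box_sum[OF a(2,4)]]
      form_eq_sym[OF mdel_mdelbar_box_sum[OF a(1,3)]]]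
  show ?thesis
    using transverse_box_sum[OF w(1,4)] smooth_box_sum[OF a(1,3)]
    unfolding Type_WK generalized_1_kahler.simps by blast
next
  case Type_S
  then obtain \<Psi> \<Phi> where w: "smooth_form X 2 \<Psi>" "real_form X \<Psi>" "form_eq X (mdiff \<Psi>) zero_form"
      "transverse_11_form X (mcomponent 1 1 \<Psi>)" "smooth_form Y 2 \<Phi>" "real_form Y \<Phi>"
      "form_eq Y (mdiff \<Phi>) zero_form" "transverse_11_form Y (mcomponent 1 1 \<Phi>)"
    using assms by auto
  \<comment> \<open>The component of the external sum is the external sum of the components, so no
    mixed terms disturb positivity.\<close>
  have "transverse_11_form (X \<times>\<^sub>M\<^sub>f Y) (mcomponent 1 1 (\<Psi> \<boxplus> \<Phi>))"
    using transverse_box_sum[OF w(4,8)]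
    unfolding mcomponent_add L.mcomponent_mpullback R.mcomponent_mpullback .
  moreover have "form_eq (X \<times>\<^sub>M\<^sub>f Y) (mdiff (\<Psi> \<boxplus> \<Phi>)) zero_form"
    using form_eq_trans[OF mdiff_box_sum[OF w(1,5)] form_eq_box_sum[OF w(3,7)]] by simp
  moreover have "real_form (X \<times>\<^sub>M\<^sub>f Y) (\<Psi> \<boxplus> \<Phi>)"
    using w(2,6) by (intro real_form_add L.real_mpullback R.real_mpullback)
  ultimately show ?thesis
    using smooth_box_sum[OF w(1,5)] unfolding Type_S generalized_1_kahler.simps by blast
next
  case Type_PL
  then obtain \<omega> \<eta> where w: "transverse_11_form X \<omega>" "form_eq X (mdel (mdelbar \<omega>)) zero_form"
      "transverse_11_form Y \<eta>" "form_eq Y (mdel (mdelbar \<eta>)) zero_form"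
    using assms by auto
  then have s: "smooth_form X 2 \<omega>" "smooth_form Y 2 \<eta>"
    by (simp_all add: transverse_11_form_def real_11_form_def)
  from form_eq_trans[OF mdel_mdelbar_box_sum[OF s] form_eq_box_sum[OF w(2,4)]]
  show ?thesis
    using transverse_box_sum[OF w(1,3)]
    unfolding Type_PL generalized_1_kahler.simps L.mpullback_zero R.mpullback_zero add_form_zero by blast
qed

end

section \<open>Base points for slices, and the equivalence for products\<close>

lemma complex_manifold_point:
  assumes "complex_manifold M"
  obtains c p where "c \<in> atlas M" "p \<in> snd c ` fst c"
  using assms unfolding complex_manifold_def by (metis UN_E ex_in_conv image_eqI)

theorem proposition5p1:
  fixes X :: "('a, 'n::finite) cmfd" and Y :: "('b, 'm::finite) cmfd" and \<T> :: kahler_type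
  assumes "complex_manifold X" and "complex_manifold Y"
  shows "generalized_1_kahler \<T> X \<and> generalized_1_kahler \<T> Y \<longleftrightarrow>
         generalized_1_kahler \<T> (X \<times>\<^sub>M\<^sub>f Y)"
proof (intro iffI conjI)
  assume "generalized_1_kahler \<T> X \<and> generalized_1_kahler \<T> Y"
  then show "generalized_1_kahler \<T> (X \<times>\<^sub>M\<^sub>f Y)"
    using complex_manifold_pair.generalized_1_kahler_prod complex_manifold_pair.intro assms by blast
next
  assume P: "generalized_1_kahler \<T> (X \<times>\<^sub>M\<^sub>f Y)"
  \<comment> \<open>Arbitrary base points in both factors select the slices to which the structure
    is restricted.\<close>
  obtain c p where c: "c \<in> atlas X" "p \<in> snd c ` fst c"
    using complex_manifold_point[OF assms(1)] .
  obtain c' q where c': "c' \<in> atlas Y" "q \<in> snd c' ` fst c'"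
    using complex_manifold_point[OF assms(2)] .
  \<comment> \<open>The linear part \<open>\<lambda>v. join_vec v 0\<close> is injective because
    \<open>left_vec\<close> recovers \<open>v\<close>.\<close>
  show "generalized_1_kahler \<T> X"
    using affine_chart_map.generalized_1_kahler_mpullback[OF left_slice[OF assms c'] _ P]
    by (metis left_join join_vec_zero)
  show "generalized_1_kahler \<T> Y"
    using affine_chart_map.generalized_1_kahler_mpullback[OF right_slice[OF assms c] _ P]
    by (metis right_join join_vec_zero)
qed

end
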